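(* For all $n \geq 0$, $p_{\xi}(12n+4) \equiv p_{\xi}(3n+1) \pmod{8}$.
   Context: $(a;q)_n=(1-a)(1-aq)\cdots(1-aq^{n-1})$, $(a;q)_0=1$. The coefficients $p_\xi(n)$ are defined by $\sum_{n\ge0}p_\xi(n)q^n=\xi(q)=1+2\sum_{n\ge1}\frac{q^{6n^2-6n+1}}{(q;q^6)_n(q^5;q^6)_n}$. *)

theory Defs
  imports
    "HOL-Computational_Algebra.Formal_Power_Series"
    "HOL-Number_Theory.Cong"
begin

definition qpoch :: "'a::comm_ring_1 \<Rightarrow> 'a \<Rightarrow> nat \<Rightarrow> 'a" where
  "qpoch a q n = (\<Prod>k<n. 1 - a * q ^ k)"

text \<open>
  The series live in \<open>\<int>[[q]]\<close>, with \<^term>\<open>fps_X\<close> as \<open>q\<close>, so that the coefficients are integers by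
  construction. As \<^typ>\<open>int\<close> is not of class \<open>inverse\<close>, the reciprocal of a series with constant
  coefficient 1 is written \<^term>\<open>fps_right_inverse f 1\<close>; see \<open>xi_denom_inverse\<close> below.
\<close>

definition xi_denom :: "nat \<Rightarrow> int fps" where
  "xi_denom n = qpoch fps_X (fps_X ^ 6) n * qpoch (fps_X ^ 5) (fps_X ^ 6) n"

definition xi_term :: "nat \<Rightarrow> int fps" where
  "xi_term n = fps_X ^ (6 * n ^ 2 - 6 * n + 1) * fps_right_inverse (xi_denom n) 1"

text \<open>
  The infinite sum is taken in the \<open>q\<close>-adic topology of \<^typ>\<open>int fps\<close>; it converges by
  \<open>summable_xi_term\<close> below. The index is shifted because the sum starts at \<open>n = 1\<close>.
\<close>

definition xi :: "int fps" where
  "xi = 1 + 2 * (\<Sum>n. xi_term (Suc n))"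

definition p_xi :: "nat \<Rightarrow> int" where
  "p_xi n = fps_nth xi n"

lemma qpoch_nth_0:
  assumes "fps_nth a 0 = 0"
  shows "fps_nth (qpoch a q n) 0 = (1 :: 'a::comm_ring_1)"
  using assms by (induction n) (simp_all add: qpoch_def)

lemma xi_denom_nth_0: "fps_nth (xi_denom n) 0 = 1"
  by (simp add: xi_denom_def qpoch_nth_0)

lemma xi_denom_inverse: "xi_denom n * fps_right_inverse (xi_denom n) 1 = 1"
  by (rule fps_right_inverse) (simp add: xi_denom_nth_0)

lemma xi_term_nth_eq_0:
  assumes "m \<le> n"
  shows "fps_nth (xi_term (Suc n)) m = 0"
proof -
  have "m < 6 * (Suc n)^2 - 6 * Suc n + 1"
    using assms by (simp add: power2_eq_square)
  then show ?thesis
    unfolding xi_term_def by (simp only: fps_X_power_mult_nth if_True)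
qed

lemma summable_xi_term: "summable (\<lambda>n. xi_term (Suc n))"
proof -
  let ?L = "Abs_fps (\<lambda>m. \<Sum>n<m. fps_nth (xi_term (Suc n)) m)"
  have "(\<lambda>N. \<Sum>n<N. xi_term (Suc n)) \<longlonglongrightarrow> ?L"
  proof (rule tendsto_fpsI)
    fix m
    have "fps_nth (\<Sum>n<N. xi_term (Suc n)) m = fps_nth ?L m" if "m \<le> N" for N
      using that
      by (auto simp: fps_sum_nth intro!: sum.mono_neutral_right xi_term_nth_eq_0)
    then show "\<forall>\<^sub>F N in sequentially. fps_nth (\<Sum>n<N. xi_term (Suc n)) m = fps_nth ?L m"
      unfolding eventually_sequentially by blast
  qed
  then show ?thesis
    unfolding summable_def sums_def by blast
qed

end

theory Submission
  imports Defs
begin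

text \<open>
  Expand each summand of \<open>\<xi>\<close> in partial fractions. Summing over the summation index with Durfee's
  rectangle identity gives, for \<open>\<xi> = 1 + 2 S\<close>,
  \<open>(q\<^sup>6;q\<^sup>6) S = \<Sum> (-1)^r q^(9r(r+1)+1) (1-q^(12r+6)) / ((1-q^(6r+1))(1-q^(6r+5)))\<close>.
  The part with exponents congruent to 1 modulo 3 is a sum of the same shape which, as the limiting
  case of the partial fractions, is an infinite product. Hence \<open>F = \<Sum> p\<^sub>\<xi>(3n+1)/2 \<cdot> q^n\<close> equals
  \<open>T(q) \<phi>(-q\<^sup>6) / \<phi>(-q\<^sup>2)\<close> with \<open>T(q) = \<Sum> q^(3i\<^sup>2+2i)\<close> and \<open>\<phi>(q) = \<Sum> q^(i\<^sup>2)\<close>, \<open>i\<close> ranging over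
  the integers, by the Jacobi triple product. Since \<open>\<phi>\<^sup>2\<close> is 1 modulo 4, \<open>F\<close> is congruent to
  \<open>T(q) \<phi>(-q\<^sup>2) \<phi>(-q\<^sup>6)\<close> modulo 4. The odd part of \<open>T(q)\<close> is \<open>q T(q\<^sup>4)\<close> and the even part of
  \<open>\<phi>(-q) \<phi>(-q\<^sup>3)\<close> is congruent to \<open>\<phi>(-q\<^sup>4) \<phi>(-q\<^sup>1\<^sup>2)\<close> modulo 4, so extracting the coefficients with
  index \<open>4n+1\<close> reproduces \<open>F\<close> modulo 4.
\<close>

section \<open>Infinite products in the X-adic topology\<close>

lemma fps_X_power_dvd_iff:
  "fps_X ^ n dvd (f :: 'a::comm_ring_1 fps) \<longleftrightarrow> (\<forall>k<n. fps_nth f k = 0)"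
proof
  assume "fps_X ^ n dvd f"
  then show "\<forall>k<n. fps_nth f k = 0"
    by (auto simp: dvd_def fps_X_power_mult_nth)
next
  assume *: "\<forall>k<n. fps_nth f k = 0"
  have "f = fps_X ^ n * fps_shift n f"
    using * by (auto simp: fps_eq_iff fps_X_power_mult_nth)
  then show "fps_X ^ n dvd f"
    by (metis dvd_triv_left)
qed

lemma fps_X_power_dvd_power:
  assumes "fps_nth (q :: 'a::comm_ring_1 fps) 0 = 0" "n \<le> m"
  shows "fps_X ^ n dvd q ^ m"
proof -
  have "fps_X ^ 1 dvd q"
    unfolding fps_X_power_dvd_iff using assms(1) by simp
  then have "fps_X ^ m dvd q ^ m"
    by (simp add: dvd_power_same)
  then show ?thesis
    using assms(2) power_le_dvd by blast
qed

lemma tendsto_fps_mult: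
  fixes f g :: "'a::comm_ring_1 fps"
  assumes "F \<longlonglongrightarrow> f" "G \<longlonglongrightarrow> g"
  shows "(\<lambda>n. F n * G n) \<longlonglongrightarrow> f * g"
proof (rule tendsto_fpsI)
  fix N
  have "\<forall>\<^sub>F n in sequentially. \<forall>i\<in>{..N}. fps_nth (F n) i = fps_nth f i \<and> fps_nth (G n) i = fps_nth g i"
    using assms by (intro eventually_ball_finite) (auto simp: tendsto_fps_iff eventually_conj)
  then show "\<forall>\<^sub>F n in sequentially. fps_nth (F n * G n) N = fps_nth (f * g) N"
    by eventually_elim (auto simp: fps_mult_nth intro!: sum.cong)
qed

text \<open>The interchanges of limit and summation below go through this criterion. It replaces an
  estimate of the difference by divisibility by powers of \<open>fps_X\<close>, which is stable
  under sums and products.\<close>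

lemma tendsto_fps_dvd:
  fixes g :: "'a::comm_ring_1 fps"
  assumes "\<And>n. fps_X ^ n dvd F n - G n" "G \<longlonglongrightarrow> g"
  shows "F \<longlonglongrightarrow> g"
proof (rule tendsto_fpsI)
  fix N
  have "\<forall>\<^sub>F n in sequentially. fps_nth (G n) N = fps_nth g N"
    using assms(2) by (auto simp: tendsto_fps_iff)
  moreover have "\<forall>\<^sub>F n in sequentially. N < n"
    by (rule eventually_gt_at_top)
  ultimately show "\<forall>\<^sub>F n in sequentially. fps_nth (F n) N = fps_nth g N"
  proof eventually_elim
    case (elim n)
    then show ?case
      using assms(1)[of n] unfolding fps_X_power_dvd_iff by force
  qed
qed

text \<open>The diagonal coefficients give the limit only when \<open>a\<close> and \<open>q\<close> have constant term 0.\<close>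

definition qpoch_inf :: "'a::comm_ring_1 fps \<Rightarrow> 'a fps \<Rightarrow> 'a fps" where
  "qpoch_inf a q = Abs_fps (\<lambda>n. fps_nth (qpoch a q n) n)"

lemma qpoch_Suc: "qpoch a q (Suc n) = qpoch a q n * (1 - a * q ^ n)"
  by (simp add: qpoch_def)

lemma qpoch_0 [simp]: "qpoch a q 0 = 1"
  by (simp add: qpoch_def)

text \<open>Each further factor differs from 1 by \<open>a * q ^ (n + k)\<close>, which has order at
  least \<open>n + 1\<close>: one from \<open>a\<close> and at least \<open>n\<close> from the power
  of \<open>q\<close>.\<close>

lemma qpoch_add_dvd:
  fixes a q :: "'a::comm_ring_1 fps"
  assumes "fps_nth a 0 = 0" "fps_nth q 0 = 0"
  shows "fps_X ^ Suc n dvd qpoch a q (n + k) - qpoch a q n"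
proof (induction k)
  case (Suc k)
  have "fps_X ^ 1 dvd a"
    unfolding fps_X_power_dvd_iff using assms by simp
  then have "fps_X ^ 1 * fps_X ^ n dvd a * q ^ (n + k)"
    by (intro mult_dvd_mono fps_X_power_dvd_power assms) simp_all
  then have "fps_X ^ Suc n dvd (qpoch a q (n + k) - qpoch a q n) - qpoch a q (n + k) * (a * q ^ (n + k))"
    using Suc by (intro dvd_diff[OF _ dvd_mult]) (simp_all only: power_one_right power_Suc)
  then show ?case
    by (simp add: qpoch_Suc algebra_simps)
qed simp

lemma qpoch_inf_dvd:
  assumes "fps_nth a 0 = 0" "fps_nth q 0 = 0"
  shows "fps_X ^ Suc n dvd qpoch_inf a q - qpoch a q n"
  unfolding fps_X_power_dvd_iff
proof (intro allI impI)
  fix k assume k: "k < Suc n"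
  then obtain j where "n = k + j"
    by (metis less_Suc_eq_le le_Suc_ex)
  then show "fps_nth (qpoch_inf a q - qpoch a q n) k = 0"
    using qpoch_add_dvd[OF assms, of k j] k
    by (auto simp: qpoch_inf_def fps_X_power_dvd_iff simp del: power_Suc)
qed

lemma tendsto_qpoch:
  assumes "fps_nth a 0 = 0" "fps_nth q 0 = 0"
  shows "qpoch a q \<longlonglongrightarrow> qpoch_inf a q"
proof (rule tendsto_fps_dvd)
  show "(\<lambda>n. qpoch_inf a q) \<longlonglongrightarrow> qpoch_inf a q"
    by simp
  show "fps_X ^ n dvd qpoch a q n - qpoch_inf a q" for n
    using power_le_dvd[OF qpoch_inf_dvd[OF assms, of n], of n]
    unfolding dvd_minus_iff[of _ "qpoch_inf a q - qpoch a q n", symmetric] by simp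
qed

lemma qpoch_inf_nth_0: "fps_nth (qpoch_inf a q) 0 = 1"
  by (simp add: qpoch_inf_def)

section \<open>Reciprocals of series and of finite products\<close>

abbreviation finv :: "int fps \<Rightarrow> int fps" where
  "finv f \<equiv> fps_right_inverse f 1"

lemma finv: "fps_nth f 0 = 1 \<Longrightarrow> f * finv f = 1"
  by (rule fps_right_inverse) simp

lemma finv_unique: "fps_nth f 0 = 1 \<Longrightarrow> f * g = 1 \<Longrightarrow> g = finv f"
  by (metis finv mult.left_commute mult.right_neutral)

lemma finv_mult:
  "fps_nth f 0 = 1 \<Longrightarrow> fps_nth g 0 = 1 \<Longrightarrow> finv (f * g) = finv f * finv g"
proof -
  assume *: "fps_nth f 0 = 1" "fps_nth g 0 = 1"
  have "(f * g) * (finv f * finv g) = (f * finv f) * (g * finv g)"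
    by (simp only: ac_simps)
  then show ?thesis
    using * by (intro finv_unique[symmetric]) (simp_all add: finv)
qed

lemma finv_1 [simp]: "finv 1 = 1"
  by (rule finv_unique[symmetric]) simp_all

text \<open>These reciprocals stand in for \<open>q\<close>-binomial coefficients, which occur below
  only as products of two of them.\<close>

definition qinv :: "int fps \<Rightarrow> nat \<Rightarrow> int fps" where
  "qinv q n = finv (qpoch q q n)"

lemma qinv_0 [simp]: "qinv q 0 = 1"
  by (simp add: qinv_def)

lemma qinv_Suc:
  assumes "fps_nth q 0 = 0"
  shows "(1 - q ^ Suc n) * qinv q (Suc n) = qinv q n"
proof -
  have *: "fps_nth (1 - q * q ^ n) 0 = 1" "fps_nth (qpoch q q n) 0 = 1"
    using assms by (simp_all add: qpoch_nth_0)
  then show ?thesis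
    unfolding qinv_def qpoch_Suc power_Suc finv_mult[OF *(2,1)]
    by (subst mult.left_commute) (simp add: finv[OF *(1)])
qed

text \<open>The quotient of \<open>(q;q)_inf\<close> by \<open>(q;q)_n\<close> consists of the
  factors \<open>1 - q ^ k\<close> with \<open>k > n\<close>.\<close>

lemma qpoch_inf_qinv_dvd:
  assumes "fps_nth q 0 = 0"
  shows "fps_X ^ Suc n dvd qpoch_inf q q * qinv q n - 1"
proof -
  have "qpoch_inf q q * qinv q n - 1 = (qpoch_inf q q - qpoch q q n) * qinv q n"
    using finv[of "qpoch q q n"] assms by (simp add: qinv_def left_diff_distrib qpoch_nth_0)
  then show ?thesis
    using qpoch_inf_dvd[OF assms assms, of n] by simp
qed

section \<open>Dissection and squaring of products\<close>

lemma qpoch_two_mul: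
  "qpoch a q (2 * n) = qpoch a (q ^ 2) n * qpoch (a * q) (q ^ 2) n"
  by (induction n) (simp_all add: qpoch_Suc power_mult[symmetric] power_add mult_ac)

lemma qpoch_three_mul:
  "qpoch a q (3 * n) = qpoch a (q ^ 3) n * qpoch (a * q) (q ^ 3) n * qpoch (a * q ^ 2) (q ^ 3) n"
proof (induction n)
  case (Suc n)
  have "3 * Suc n = Suc (Suc (Suc (3 * n)))"
    by simp
  then have "qpoch a q (3 * Suc n) = qpoch a q (3 * n) * (1 - a * q ^ (3 * n)) * (1 - a * q ^ Suc (3 * n)) * (1 - a * q ^ Suc (Suc (3 * n)))"
    by (simp only: qpoch_Suc)
  then show ?case
    unfolding Suc.IH by (simp add: qpoch_Suc power_mult[symmetric] power2_eq_square mult_ac)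
qed simp

lemma qpoch_square:
  "qpoch a q n * qpoch (- a) q n = qpoch (a * a) (q ^ 2) n"
proof (induction n)
  case (Suc n)
  have "(1 - a * q ^ n) * (1 - (- a) * q ^ n) = 1 - (a * a) * (q ^ 2) ^ n"
    by (simp add: algebra_simps power2_eq_square power_mult_distrib)
  then have "qpoch (a * a) (q ^ 2) (Suc n) = qpoch a q n * qpoch (- a) q n * ((1 - a * q ^ n) * (1 - (- a) * q ^ n))"
    by (simp only: qpoch_Suc Suc.IH)
  then show ?case
    by (simp only: qpoch_Suc mult_ac)
qed simp

lemma tendsto_qpoch_mult:
  assumes "fps_nth a 0 = 0" "fps_nth q 0 = 0" "k > 0"
  shows "(\<lambda>n. qpoch a q (k * n)) \<longlonglongrightarrow> qpoch_inf a q"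
  using LIMSEQ_subseq_LIMSEQ[OF tendsto_qpoch[OF assms(1,2)], of "\<lambda>n. k * n"] assms(3)
  by (simp add: strict_mono_def comp_def)

lemma qpoch_inf_split2:
  assumes "fps_nth a 0 = 0" "fps_nth q 0 = 0"
  shows "qpoch_inf a q = qpoch_inf a (q ^ 2) * qpoch_inf (a * q) (q ^ 2)"
proof (rule LIMSEQ_unique[OF tendsto_qpoch_mult[OF assms, of 2]])
  show "(\<lambda>n. qpoch a q (2 * n)) \<longlonglongrightarrow> qpoch_inf a (q ^ 2) * qpoch_inf (a * q) (q ^ 2)"
    unfolding qpoch_two_mul using assms
    by (intro tendsto_fps_mult tendsto_qpoch) (simp_all add: power2_eq_square)
qed simp

lemma qpoch_inf_split3:
  assumes "fps_nth a 0 = 0" "fps_nth q 0 = 0"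
  shows "qpoch_inf a q = qpoch_inf a (q ^ 3) * qpoch_inf (a * q) (q ^ 3) * qpoch_inf (a * q ^ 2) (q ^ 3)"
proof (rule LIMSEQ_unique[OF tendsto_qpoch_mult[OF assms, of 3]])
  show "(\<lambda>n. qpoch a q (3 * n)) \<longlonglongrightarrow> qpoch_inf a (q ^ 3) * qpoch_inf (a * q) (q ^ 3) * qpoch_inf (a * q ^ 2) (q ^ 3)"
    unfolding qpoch_three_mul using assms
    by (intro tendsto_fps_mult tendsto_qpoch) (simp_all add: fps_power_zeroth)
qed simp

lemma qpoch_inf_square:
  assumes "fps_nth a 0 = 0" "fps_nth q 0 = 0"
  shows "qpoch_inf a q * qpoch_inf (- a) q = qpoch_inf (a * a) (q ^ 2)"
proof (rule LIMSEQ_unique)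
  show "(\<lambda>n. qpoch a q n * qpoch (- a) q n) \<longlonglongrightarrow> qpoch_inf a q * qpoch_inf (- a) q"
    using assms by (intro tendsto_fps_mult tendsto_qpoch) simp_all
  show "(\<lambda>n. qpoch a q n * qpoch (- a) q n) \<longlonglongrightarrow> qpoch_inf (a * a) (q ^ 2)"
    unfolding qpoch_square using assms by (intro tendsto_qpoch) (simp_all add: fps_power_zeroth)
qed

section \<open>Partial fractions and the Durfee rectangle\<close>

lemma choose2_Suc: "Suc n choose 2 = n + (n choose 2)"
  by (simp add: numeral_2_eq_2)

text \<open>Partial sums have a closed form, which makes the proof a plain induction; only the vanishing of
  the complete sum \<open>R = n\<close> matters.\<close>

lemma sum_alternating_qinv:
  assumes q: "fps_nth q 0 = 0" and "R < n"
  shows "(1 - q ^ n) * (\<Sum>r\<le>R. (-1) ^ r * q ^ (r choose 2) * (1 - q ^ (2 * r + 1)) * qinv q (n - r) * qinv q (n + 1 + r))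
    = (-1) ^ R * q ^ (Suc R choose 2) * (1 - q ^ Suc R) * qinv q (n - 1 - R) * qinv q (n + 1 + R)"
  using \<open>R < n\<close>
proof (induction R)
  case 0
  then obtain m where m: "n = Suc m"
    by (cases n) auto
  show ?case
    using qinv_Suc[OF q, of m] by (simp add: m choose2_Suc binomial_eq_0 mult_ac)
next
  case (Suc R)
  then obtain m where n: "n = Suc R + Suc m"
    by (metis add_Suc_right less_iff_Suc_add)
  define A M c u w where "A = q ^ Suc R" "M = q ^ Suc m" "c = q ^ (Suc R choose 2)"
    "u = qinv q (Suc m)" "w = qinv q (n + 1 + Suc R)"
  note defs = this
  have m: "qinv q (n - 1 - Suc R) = (1 - M) * u"
    using qinv_Suc[OF q, of m] n by (simp add: defs)
  have k: "qinv q (n + 1 + R) = (1 - A * A * M * q) * w"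
    using qinv_Suc[OF q, of "n + 1 + R"] n by (simp add: defs power_add mult_ac)
  have c: "q ^ (Suc (Suc R) choose 2) = c * A"
    unfolding defs by (simp only: choose2_Suc[of "Suc R"] power_add mult.commute)
  have e: "q ^ n = A * M" "q ^ (2 * Suc R + 1) = A * A * q" "q ^ Suc (Suc R) = A * q"
    "n - 1 - R = Suc m" "n - Suc R = Suc m"
    unfolding defs mult_2 n by (simp_all add: power_add mult_ac)
  have IH: "(1 - A * M) * (\<Sum>r\<le>R. (-1) ^ r * q ^ (r choose 2) * (1 - q ^ (2 * r + 1)) * qinv q (n - r) * qinv q (n + 1 + r))
    = (-1) ^ R * c * (1 - A) * u * ((1 - A * A * M * q) * w)"
    using Suc.IH[OF Suc_lessD[OF Suc.prems]] unfolding e defs(1-4)[symmetric] k .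
  show ?case
    unfolding sum.atMost_Suc distrib_left m c e IH defs(3)[symmetric] defs(4)[symmetric] defs(5)[symmetric]
    by (simp add: algebra_simps)
qed

text \<open>The closed form at \<open>R = n - 1\<close> is cancelled by the last summand, because
  \<open>qinv q (2 * n) = (1 - q ^ (2 * n + 1)) * qinv q (2 * n + 1)\<close>. The factor
  \<open>1 - q ^ n\<close> is then removed in an integral domain.\<close>

lemma sum_alternating_qinv_eq_0:
  assumes q: "fps_nth q 0 = 0" and "n > 0"
  shows "(\<Sum>r\<le>n. (-1) ^ r * q ^ (r choose 2) * (1 - q ^ (2 * r + 1)) * qinv q (n - r) * qinv q (n + 1 + r)) = 0"
    (is "sum ?f _ = 0")
proof -
  obtain m where n: "n = Suc m"
    using \<open>n > 0\<close> by (cases n) auto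
  have m: "qinv q (n + 1 + m) = (1 - q ^ (2 * n + 1)) * qinv q (n + 1 + n)"
    using qinv_Suc[OF q, of "n + 1 + m"] by (simp add: n mult_2)
  have "(1 - q ^ n) * sum ?f {..m} = (-1) ^ m * q ^ (n choose 2) * (1 - q ^ n) * qinv q 0 * qinv q (n + 1 + m)"
    using sum_alternating_qinv[OF q, of m n] by (simp add: n)
  moreover have "sum ?f {..n} = sum ?f {..m} + ?f n"
    by (simp add: n)
  moreover have "?f n = - ((-1) ^ m * q ^ (n choose 2) * qinv q 0 * qinv q (n + 1 + m))"
    unfolding m by (simp add: n mult_ac)
  ultimately have "(1 - q ^ n) * sum ?f {..n} = 0"
    by (simp only: distrib_left) (simp add: mult_ac)
  moreover have "fps_nth (1 - q ^ n) 0 = 1"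
    using q \<open>n > 0\<close> by (simp add: fps_power_zeroth)
  then have "1 - q ^ n \<noteq> 0"
    by (metis fps_zero_nth zero_neq_one)
  ultimately show ?thesis
    by simp
qed

text \<open>Passing from \<open>n\<close> to \<open>n + 1\<close> multiplies the product by
  \<open>D (n + 1)\<close>, so the induction only needs that \<open>D (n + 1)\<close> times the new
  sum is the old sum. Because of \<open>u * v = q\<close>, the factor \<open>D r\<close> depends on
  \<open>u\<close> and \<open>v\<close> only through \<open>u + v\<close>.\<close>

lemma partial_fractions_qpoch:
  fixes u v q :: "int fps"
  assumes q: "fps_nth q 0 = 0" and u: "fps_nth u 0 = 0" and v: "fps_nth v 0 = 0" and uv: "u * v = q"
  defines "D \<equiv> \<lambda>r. (1 - u * q ^ r) * (1 - v * q ^ r)"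
  shows "finv (qpoch u q (Suc n) * qpoch v q (Suc n)) =
    (\<Sum>r\<le>n. (-1) ^ r * q ^ (Suc r choose 2) * (1 - q ^ (2 * r + 1)) * qinv q (n - r) * qinv q (n + 1 + r) * finv (D r))"
proof (induction n)
  case 0
  show ?case
    using qinv_Suc[OF q, of 0] by (simp add: qpoch_Suc D_def choose2_Suc binomial_eq_0)
next
  case (Suc n)
  define R where "R = (\<lambda>n. \<Sum>r\<le>n. (-1) ^ r * q ^ (Suc r choose 2) * (1 - q ^ (2 * r + 1)) * qinv q (n - r) * qinv q (n + 1 + r) * finv (D r))"
  define N where "N = Suc n"
  have D0: "fps_nth (D r) 0 = 1" for r
    using u v by (simp add: D_def)
  have D_eq: "D r = 1 - (u + v) * q ^ r + q ^ (2 * r + 1)" for r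
    unfolding D_def uv[symmetric] by (simp add: algebra_simps power_mult_distrib mult_2_right power_add)
  \<comment> \<open>Division of \<open>D N\<close> by \<open>D r\<close> with remainder. The
    remainder is free of \<open>u\<close> and \<open>v\<close>, and its two factors are those that
    lower the indices of \<open>qinv q (N - r)\<close> and \<open>qinv q (N + 1 + r)\<close> by
    one.\<close>
  have D_rec: "D N = q ^ (N - r) * D r + (1 - q ^ (N - r)) * (1 - q ^ (N + 1 + r))" if rN: "r \<le> N" for r
  proof -
    obtain j where j: "N = r + j"
      using le_Suc_ex[OF rN] by blast
    show ?thesis
      unfolding D_eq j by (simp add: algebra_simps power_add mult_2_right)
  qed
  define g where "g = (\<lambda>r. (-1) ^ r * q ^ (Suc r choose 2) * (1 - q ^ (2 * r + 1)) * qinv q (N - r) * qinv q (N + 1 + r))"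
  have "D N * R N = (\<Sum>r\<le>N. g r * (D N * finv (D r)))"
    by (simp add: R_def g_def sum_distrib_left mult_ac)
  also have "\<dots> = (\<Sum>r\<le>N. g r * q ^ (N - r) + g r * (1 - q ^ (N - r)) * (1 - q ^ (N + 1 + r)) * finv (D r))"
  proof (rule sum.cong[OF refl])
    fix r assume "r \<in> {..N}"
    then have "D N * finv (D r) = q ^ (N - r) * (D r * finv (D r)) + (1 - q ^ (N - r)) * (1 - q ^ (N + 1 + r)) * finv (D r)"
      by (subst D_rec[of r]) (simp_all only: atMost_iff distrib_right mult.assoc)
    then show "g r * (D N * finv (D r)) = g r * q ^ (N - r) + g r * (1 - q ^ (N - r)) * (1 - q ^ (N + 1 + r)) * finv (D r)"
      by (simp only: finv[OF D0] distrib_left mult.assoc mult_1_right)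
  qed
  also have "\<dots> = (\<Sum>r\<le>N. g r * q ^ (N - r)) + (\<Sum>r\<le>N. g r * (1 - q ^ (N - r)) * (1 - q ^ (N + 1 + r)) * finv (D r))"
    by (rule sum.distrib)
  \<comment> \<open>The quotients contribute no denominators \<open>D r\<close> and add up to the
    alternating sum that vanishes; the remainders give \<open>R n\<close>.\<close>
  also have "(\<Sum>r\<le>N. g r * q ^ (N - r)) = q ^ N *
      (\<Sum>r\<le>N. (-1) ^ r * q ^ (r choose 2) * (1 - q ^ (2 * r + 1)) * qinv q (N - r) * qinv q (N + 1 + r))"
    unfolding sum_distrib_left
  proof (rule sum.cong[OF refl])
    fix r assume "r \<in> {..N}"
    then have e: "q ^ (Suc r choose 2) * q ^ (N - r) = q ^ N * q ^ (r choose 2)"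
      unfolding power_add[symmetric] choose2_Suc by (simp add: add.commute)
    have "g r * q ^ (N - r) = (q ^ (Suc r choose 2) * q ^ (N - r)) * ((-1) ^ r * (1 - q ^ (2 * r + 1)) * qinv q (N - r) * qinv q (N + 1 + r))"
      unfolding g_def by (simp only: mult_ac)
    then show "g r * q ^ (N - r) = q ^ N * ((-1) ^ r * q ^ (r choose 2) * (1 - q ^ (2 * r + 1)) * qinv q (N - r) * qinv q (N + 1 + r))"
      unfolding e by (simp only: mult_ac)
  qed
  also have "\<dots> = 0"
    by (subst sum_alternating_qinv_eq_0[OF q]) (simp_all add: N_def)
  also have "(\<Sum>r\<le>N. g r * (1 - q ^ (N - r)) * (1 - q ^ (N + 1 + r)) * finv (D r))
      = (\<Sum>r\<le>n. g r * (1 - q ^ (N - r)) * (1 - q ^ (N + 1 + r)) * finv (D r))"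
    by (simp add: N_def)
  also have "\<dots> = R n"
    unfolding R_def
  proof (rule sum.cong[OF refl])
    fix r assume "r \<in> {..n}"
    then have "N - r = Suc (n - r)" "N + 1 + r = Suc (n + 1 + r)"
      by (auto simp: N_def)
    then have e: "qinv q (n - r) = (1 - q ^ (N - r)) * qinv q (N - r)"
      "qinv q (n + 1 + r) = (1 - q ^ (N + 1 + r)) * qinv q (N + 1 + r)"
      using qinv_Suc[OF q, of "n - r", symmetric] qinv_Suc[OF q, of "n + 1 + r", symmetric]
      by (simp_all only:)
    show "g r * (1 - q ^ (N - r)) * (1 - q ^ (N + 1 + r)) * finv (D r) =
      (-1) ^ r * q ^ (Suc r choose 2) * (1 - q ^ (2 * r + 1)) * qinv q (n - r) * qinv q (n + 1 + r) * finv (D r)"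
      unfolding g_def e by (simp only: mult_ac)
  qed
  finally have rec: "D N * R N = R n"
    by simp
  have "qpoch u q (Suc N) * qpoch v q (Suc N) = (qpoch u q N * qpoch v q N) * D N"
    by (simp add: qpoch_Suc D_def mult_ac)
  then have "finv (qpoch u q (Suc N) * qpoch v q (Suc N)) = finv (qpoch u q N * qpoch v q N) * finv (D N)"
    by (simp add: finv_mult D0 qpoch_nth_0 u v)
  also have "\<dots> = R n * finv (D N)"
    using Suc.IH by (simp add: R_def N_def)
  also have "\<dots> = R N * (D N * finv (D N))"
    unfolding rec[symmetric] by (simp only: mult_ac)
  also have "\<dots> = R N"
    by (simp add: finv D0)
  finally show ?case
    by (simp only: R_def N_def)
qed

text \<open>Modulo \<open>fps_X ^ M\<close> the sum does not depend on \<open>k\<close>. For large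
  \<open>k\<close> only the summand \<open>m = 0\<close> survives, namely \<open>qinv q k\<close>,
  and this approaches the reciprocal of \<open>(q;q)_inf\<close>.\<close>

lemma durfee_rectangle_dvd:
  assumes q: "fps_nth q 0 = 0"
  shows "fps_X ^ M dvd qpoch_inf q q * (\<Sum>m<M. q ^ (m * (m + k)) * qinv q m * qinv q (m + k)) - 1"
proof (cases "M = 0")
  case False
  define G where "G = (\<lambda>k. \<Sum>m<M. q ^ (m * (m + k)) * qinv q m * qinv q (m + k))"
  define H where "H = (\<lambda>k. G k - G (Suc k))"
  have I: "qinv q n = (1 - q ^ Suc n) * qinv q (Suc n)" for n
    using qinv_Suc[OF q] by simp
  have qM: "fps_X ^ j dvd q ^ i" if "j \<le> i" for i j
    using fps_X_power_dvd_power[OF q that] .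
  have H_eq: "H k = (\<Sum>m<M. q ^ (m * (m + k)) * qinv q m * qinv q (Suc (m + k)) * (1 - q ^ m - q ^ Suc (m + k)))" for k
    unfolding H_def G_def sum_subtractf[symmetric]
  proof (rule sum.cong[OF refl])
    fix m
    have "q ^ (m * (m + Suc k)) = q ^ (m * (m + k)) * q ^ m"
      by (simp add: power_add)
    then show "q ^ (m * (m + k)) * qinv q m * qinv q (m + k) - q ^ (m * (m + Suc k)) * qinv q m * qinv q (m + Suc k)
       = q ^ (m * (m + k)) * qinv q m * qinv q (Suc (m + k)) * (1 - q ^ m - q ^ Suc (m + k))"
      unfolding I[of "m + k"] by (simp add: algebra_simps)
  qed
  \<comment> \<open>Up to truncation \<open>H k = - q^(k+1) H (k+1)\<close>, so iterating shows that every \<open>H k\<close> vanishes.\<close>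
  have H_rec: "fps_X ^ M dvd H k + q ^ Suc k * H (Suc k)" for k
  proof -
    \<comment> \<open>The terms of the recurrence telescope through \<open>t\<close>. The indicator
      enforces \<open>t 0 = 0\<close>, where \<open>m - 1\<close> would be truncated to 0; at the
      upper end \<open>q ^ (M * (M + k))\<close> makes \<open>t M\<close> negligible.\<close>
    define t where "t = (\<lambda>m. q ^ (m * (m + k)) * qinv q (m - 1) * qinv q (Suc (m + k)) * (if m = 0 then 0 else 1))"
    have "q ^ (m * (m + k)) * qinv q m * qinv q (Suc (m + k)) * (1 - q ^ m - q ^ Suc (m + k)) =
      t m - q ^ (m * (m + k)) * qinv q m * qinv q (Suc (m + k)) * q ^ Suc (m + k)" for m
    proof (cases m)
      case (Suc i)
      then show ?thesis
        by (simp add: t_def I[of i] algebra_simps)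
    qed (simp add: t_def)
    moreover have "q ^ Suc k * (q ^ (m * (m + Suc k)) * qinv q m * qinv q (Suc (m + Suc k)) * (1 - q ^ m - q ^ Suc (m + Suc k)))
      = q ^ (m * (m + k)) * qinv q m * qinv q (Suc (m + k)) * q ^ Suc (m + k) - t (Suc m)" for m
      unfolding t_def I[of "Suc (m + k)"] by (simp add: algebra_simps power_add)
    ultimately have "H k + q ^ Suc k * H (Suc k) = (\<Sum>m<M. t m - t (Suc m))"
      unfolding H_eq sum_distrib_left sum.distrib[symmetric] by (intro sum.cong) simp_all
    also have "\<dots> = t 0 - t M"
      by (induction M) simp_all
    also have "\<dots> = - t M"
      by (simp add: t_def)
    finally show ?thesis
      by (simp add: t_def qM)
  qed
  have H_dvd: "fps_X ^ j dvd H k" if "j \<le> M" for j k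
    using that
  proof (induction j arbitrary: k)
    case (Suc j)
    have "fps_X ^ 1 * fps_X ^ j dvd q ^ Suc k * H (Suc k)"
      using Suc by (intro mult_dvd_mono qM Suc.IH) simp_all
    moreover have "fps_X ^ Suc j dvd H k + q ^ Suc k * H (Suc k)"
      using H_rec Suc.prems power_le_dvd by blast
    ultimately show ?case
      by (simp add: dvd_add_left_iff)
  qed simp
  have G_dvd: "fps_X ^ M dvd G k - G (k + j)" for j
  proof (induction j)
    case (Suc j)
    have eq: "G k - G (k + Suc j) = (G k - G (k + j)) + H (k + j)"
      by (simp add: H_def)
    show ?case
      unfolding eq using Suc.IH H_dvd[of M "k + j"] by (intro dvd_add) simp_all
  qed simp
  obtain M' where M': "M = Suc M'"
    using False by (cases M) auto
  \<comment> \<open>This shift is large enough twice over: all summands with \<open>m > 0\<close>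
    acquire order at least \<open>M\<close>, and \<open>qinv q l\<close> inverts the infinite
    product up to order \<open>M\<close>.\<close>
  define l where "l = k + M"
  have "fps_X ^ M dvd (\<Sum>m<M'. q ^ (Suc m * (Suc m + l)) * qinv q (Suc m) * qinv q (Suc m + l))"
    by (intro dvd_sum dvd_mult2 qM) (simp add: l_def)
  then have "fps_X ^ M dvd G l - qinv q l"
    by (simp add: G_def M' sum.lessThan_Suc_shift del: sum.lessThan_Suc power_Suc mult_Suc)
  then have "fps_X ^ M dvd (G k - G l) + (G l - qinv q l)"
    using G_dvd[of M] by (intro dvd_add) (simp_all add: l_def)
  then have "fps_X ^ M dvd qpoch_inf q q * (G k - qinv q l)"
    by simp
  moreover have "fps_X ^ M dvd qpoch_inf q q * qinv q l - 1"
    using qpoch_inf_qinv_dvd[OF q, of l] by (rule power_le_dvd) (simp add: l_def)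
  ultimately have "fps_X ^ M dvd qpoch_inf q q * (G k - qinv q l) + (qpoch_inf q q * qinv q l - 1)"
    by (rule dvd_add)
  then show ?thesis
    by (simp add: G_def algebra_simps)
qed simp

section \<open>The Jacobi triple product\<close>

lemma q_binomial_theorem:
  fixes a b q :: "int fps"
  assumes q: "fps_nth q 0 = 0"
  shows "qinv q n * (\<Prod>k<n. a + b * q ^ k) =
    (\<Sum>k\<le>n. qinv q k * qinv q (n - k) * q ^ (k choose 2) * a ^ (n - k) * b ^ k)"
proof (induction n)
  case 0
  show ?case
    by (simp add: binomial_eq_0)
next
  case (Suc n)
  define t where "t = (\<lambda>n k. qinv q k * qinv q (n - k) * q ^ (k choose 2) * a ^ (n - k) * b ^ k)"
  \<comment> \<open>\<open>A\<close> and \<open>B\<close> are the two parts of the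
    \<open>q\<close>-Pascal rule, coming from \<open>1 - q ^ (n + 1) = (1 - q ^ (n + 1 - k)) + q ^
    (n + 1 - k) * (1 - q ^ k)\<close>. The first factor lowers the index \<open>n + 1 - k\<close>,
    the second lowers \<open>k\<close>.\<close>
  define A where "A = (\<lambda>k. (1 - q ^ (Suc n - k)) * t (Suc n) k)"
  define B where "B = (\<lambda>k. q ^ (Suc n - k) * (1 - q ^ k) * t (Suc n) k)"
  have AB: "(1 - q ^ Suc n) * t (Suc n) k = A k + B k" if "k \<le> Suc n" for k
  proof -
    have "q ^ (Suc n - k) * q ^ k = q ^ Suc n"
      using that by (simp flip: power_add del: power_Suc)
    then show ?thesis
      unfolding A_def B_def by (simp add: algebra_simps del: power_Suc)
  qed
  have A: "A k = t n k * a" if "k \<le> n" for k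
    using that qinv_Suc[OF q, of "n - k", symmetric]
    by (simp add: A_def t_def Suc_diff_le mult_ac)
  have B: "B (Suc k) = t n k * (b * q ^ n)" if "k \<le> n" for k
  proof -
    have e: "q ^ (n - k) * q ^ (Suc k choose 2) = q ^ (k choose 2) * q ^ n"
      unfolding power_add[symmetric] choose2_Suc using that by (simp add: add.commute)
    have "B (Suc k) = (q ^ (n - k) * q ^ (Suc k choose 2)) * ((1 - q ^ Suc k) * qinv q (Suc k)) * qinv q (n - k) * a ^ (n - k) * b ^ Suc k"
      unfolding B_def t_def diff_Suc_Suc by (simp only: mult_ac)
    also have "\<dots> = t n k * (b * q ^ n)"
      unfolding e qinv_Suc[OF q] t_def by (simp add: mult_ac)
    finally show ?thesis .
  qed
  have "(1 - q ^ Suc n) * (\<Sum>k\<le>Suc n. t (Suc n) k) = (\<Sum>k\<le>Suc n. A k + B k)"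
    unfolding sum_distrib_left by (intro sum.cong AB) simp_all
  also have "\<dots> = sum A {..Suc n} + sum B {..Suc n}"
    by (rule sum.distrib)
  also have "sum A {..Suc n} = sum A {..n}"
    by (simp add: A_def)
  also have "\<dots> = (\<Sum>k\<le>n. t n k * a)"
    by (intro sum.cong A) simp_all
  also have "sum B {..Suc n} = (\<Sum>k\<le>n. B (Suc k))"
    by (subst sum.atMost_Suc_shift) (simp add: B_def)
  also have "\<dots> = (\<Sum>k\<le>n. t n k * (b * q ^ n))"
    by (intro sum.cong B) simp_all
  also have "(\<Sum>k\<le>n. t n k * a) + \<dots> = (\<Sum>k\<le>n. t n k) * (a + b * q ^ n)"
    by (simp add: sum_distrib_right distrib_left)
  also have "\<dots> = qinv q n * (\<Prod>k<Suc n. a + b * q ^ k)"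
    using Suc.IH by (simp add: t_def mult_ac)
  also have "\<dots> = (1 - q ^ Suc n) * (qinv q (Suc n) * (\<Prod>k<Suc n. a + b * q ^ k))"
    unfolding qinv_Suc[OF q, of n, symmetric] by (simp only: mult_ac)
  finally have "(1 - q ^ Suc n) * (\<Sum>k\<le>Suc n. t (Suc n) k) = (1 - q ^ Suc n) * (qinv q (Suc n) * (\<Prod>k<Suc n. a + b * q ^ k))" .
  moreover have "fps_nth (1 - q ^ Suc n) 0 = 1"
    using q by simp
  then have "1 - q ^ Suc n \<noteq> 0"
    by (metis fps_zero_nth zero_neq_one)
  ultimately show ?case
    by (simp add: t_def del: power_Suc sum.atMost_Suc prod.lessThan_Suc)
qed

text \<open>The bilateral series with terms \<open>s ^ i * q ^ (c * i^2 + d * i)\<close>. For a sign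
  \<open>s\<close> the absolute value changes nothing and keeps the exponent natural. In the
  notation above, \<open>theta 1 3 2\<close> is \<open>T(q)\<close> and
  \<open>theta (-1) c 0\<close> is \<open>phi(-q^c)\<close>.\<close>

definition theta :: "int \<Rightarrow> nat \<Rightarrow> nat \<Rightarrow> int fps" where
  "theta s c d = Abs_fps (\<lambda>n. \<Sum>i | int c * i\<^sup>2 + int d * i = int n. s ^ nat \<bar>i\<bar>)"

text \<open>For \<open>i\<close> nonzero, \<open>c * |i| - d >= 1\<close>. The bound shows that
  exponents are nonnegative and that each one is attained finitely often, and it controls the tails
  in the triple product.\<close>

lemma abs_le_theta_exponent:
  fixes i :: int
  assumes "d < c"
  shows "\<bar>i\<bar> \<le> int c * i\<^sup>2 + int d * i"
proof -
  have "\<bar>i\<bar> * 1 \<le> \<bar>i\<bar> * (int c * \<bar>i\<bar> - int d)" if "i \<noteq> 0"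
  proof (intro mult_left_mono)
    have "int c * 1 \<le> int c * \<bar>i\<bar>"
      using that by (intro mult_left_mono) auto
    then show "1 \<le> int c * \<bar>i\<bar> - int d"
      using assms by linarith
  qed simp
  moreover have "\<bar>i\<bar> * (int c * \<bar>i\<bar> - int d) = int c * i\<^sup>2 - int d * \<bar>i\<bar>"
    by (simp add: algebra_simps power2_eq_square)
  moreover have "- (int d * \<bar>i\<bar>) \<le> int d * i"
    by (metis abs_ge_minus_self abs_mult abs_of_nat minus_le_iff)
  ultimately show ?thesis
    by (cases "i = 0") auto
qed

lemma finite_theta_indices:
  assumes "d < c"
  shows "finite {i::int. int c * i\<^sup>2 + int d * i = int n}"
proof (rule finite_subset)
  show "{i::int. int c * i\<^sup>2 + int d * i = int n} \<subseteq> {- int n..int n}"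
    using abs_le_theta_exponent[OF assms] by (auto simp: abs_le_iff) (smt (verit))+
qed simp

lemma prod_lessThan_add:
  fixes n m :: nat
  shows "(\<Prod>k<n + m. f k) = (\<Prod>k<n. f k) * (\<Prod>k<m. f (n + k) :: 'a::comm_monoid_mult)"
  by (induction m) (simp_all add: mult_ac)

lemma prod_X_power_linear:
  "(\<Prod>k<n. (fps_X :: 'a::comm_ring_1 fps) ^ (c + d + 2 * c * k)) = fps_X ^ (n * (c * n + d))"
  by (induction n) (simp_all add: algebra_simps flip: power_add power_Suc)

lemma double_choose2: "2 * (k choose 2) + k = k * k"
  by (induction k) (simp_all add: choose2_Suc binomial_eq_0)

text \<open>The product of \<open>?a + ?b * q ^ k\<close> over \<open>k < 2 * n\<close> is cut in
  the middle: below \<open>n\<close> the second summand is pulled out, from \<open>n\<close> on the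
  first. The two halves become the two finite products, and centring the binomial sum at
  \<open>k = n\<close> yields the quadratic exponent.\<close>

lemma finite_jacobi_triple_product:
  fixes e :: "int fps"
  assumes "d < c" and e: "e * e = 1"
  defines "q \<equiv> fps_X ^ (2 * c)"
  shows "qpoch (- (e * fps_X ^ (c + d))) q n * qpoch (- (e * fps_X ^ (c - d))) q n * qinv q (2 * n) =
    (\<Sum>k\<le>2 * n. qinv q k * qinv q (2 * n - k) * e ^ (n + k) *
      fps_X ^ nat (int c * (int k - int n)\<^sup>2 + int d * (int k - int n)))"
    (is "?P = (\<Sum>k\<le>2 * n. ?c k * e ^ (n + k) * fps_X ^ ?p k)")
proof -
  \<comment> \<open>The power of \<open>fps_X\<close> pulled out of the factors:
    \<open>2 * c * n * n\<close> from the upper half and \<open>n * (c * n + d)\<close> from the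
    lower one.\<close>
  define M where "M = 2 * c * n * n + n * (c * n + d)"
  \<comment> \<open>The \<open>q\<close>-binomial theorem in homogeneous form avoids the negative powers of the usual argument.\<close>
  let ?a = "fps_X ^ (2 * c * n)" and ?b = "e * fps_X ^ (c + d)"
  have q: "fps_nth q 0 = 0"
    using \<open>d < c\<close> by (simp add: q_def)
  \<comment> \<open>Pulling \<open>?b * q ^ k\<close> out leaves a factor with
    \<open>q ^ (n - Suc k)\<close>, so the order of the factors is reversed.\<close>
  have "(\<Prod>k<n. ?a + ?b * q ^ k) = (\<Prod>j<n. ?a + ?b * q ^ (n - Suc j))"
    by (rule prod.nat_diff_reindex[symmetric])
  also have "\<dots> = (\<Prod>j<n. (e * fps_X ^ (c + d + 2 * c * (n - Suc j))) * (1 - (- (e * fps_X ^ (c - d))) * q ^ j))"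
  proof (rule prod.cong[OF refl])
    fix j assume "j \<in> {..<n}"
    then obtain m where n: "n = Suc (j + m)"
      by (metis lessThan_iff less_iff_Suc_add)
    have ex: "c + d + 2 * c * m + (c - d + 2 * c * j) = 2 * c * n"
      using \<open>d < c\<close> by (simp add: n algebra_simps)
    have a: "?a = fps_X ^ (c + d + 2 * c * m) * fps_X ^ (c - d + 2 * c * j)"
      by (simp only: ex power_add[symmetric])
    have "(e * fps_X ^ (c + d + 2 * c * m)) * (1 - (- (e * fps_X ^ (c - d))) * q ^ j)
        = e * fps_X ^ (c + d + 2 * c * m) + (e * e) * (fps_X ^ (c + d + 2 * c * m) * fps_X ^ (c - d + 2 * c * j))"
      by (simp add: q_def power_add algebra_simps flip: power_mult)
    also have "\<dots> = ?a + ?b * q ^ m"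
      unfolding e a[symmetric] by (simp add: q_def power_add algebra_simps flip: power_mult)
    finally show "?a + ?b * q ^ (n - Suc j) = (e * fps_X ^ (c + d + 2 * c * (n - Suc j))) * (1 - (- (e * fps_X ^ (c - d))) * q ^ j)"
      by (simp add: n)
  qed
  also have "\<dots> = e ^ n * (\<Prod>j<n. fps_X ^ (c + d + 2 * c * (n - Suc j))) * qpoch (- (e * fps_X ^ (c - d))) q n"
    unfolding qpoch_def by (simp only: prod.distrib prod_constant card_lessThan)
  also have "(\<Prod>j<n. (fps_X :: int fps) ^ (c + d + 2 * c * (n - Suc j))) = fps_X ^ (n * (c * n + d))"
    using prod.nat_diff_reindex[of "\<lambda>k. (fps_X :: int fps) ^ (c + d + 2 * c * k)" n]
    unfolding prod_X_power_linear .
  finally have P1: "(\<Prod>k<n. ?a + ?b * q ^ k) = e ^ n * fps_X ^ (n * (c * n + d)) * qpoch (- (e * fps_X ^ (c - d))) q n" .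
  have "(\<Prod>k<n. ?a + ?b * q ^ (n + k)) = (\<Prod>k<n. ?a * (1 - (- ?b) * q ^ k))"
    by (rule prod.cong) (simp_all add: q_def power_add algebra_simps flip: power_mult)
  also have "\<dots> = fps_X ^ (2 * c * n * n) * qpoch (- ?b) q n"
    by (simp add: prod.distrib qpoch_def power_mult)
  finally have P2: "(\<Prod>k<n. ?a + ?b * q ^ (n + k)) = fps_X ^ (2 * c * n * n) * qpoch (- ?b) q n" .
  have "(\<Prod>k<2 * n. ?a + ?b * q ^ k) = (\<Prod>k<n. ?a + ?b * q ^ k) * (\<Prod>k<n. ?a + ?b * q ^ (n + k))"
    unfolding mult_2[of n] by (rule prod_lessThan_add)
  also have "\<dots> = e ^ n * fps_X ^ M * (qpoch (- ?b) q n * qpoch (- (e * fps_X ^ (c - d))) q n)"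
    unfolding P1 P2 by (simp only: M_def power_add mult_ac)
  finally have "e ^ n * fps_X ^ M * ?P = qinv q (2 * n) * (\<Prod>k<2 * n. ?a + ?b * q ^ k)"
    by (simp only: mult_ac)
  also have "\<dots> = (\<Sum>k\<le>2 * n. ?c k * q ^ (k choose 2) * ?a ^ (2 * n - k) * ?b ^ k)"
    by (rule q_binomial_theorem[OF q])
  also have "\<dots> = (\<Sum>k\<le>2 * n. fps_X ^ M * (?c k * e ^ k * fps_X ^ ?p k))"
  proof (rule sum.cong[OF refl])
    fix k assume k: "k \<in> {..2 * n}"
    have "int k * int k = 2 * int (k choose 2) + int k"
      using arg_cong[OF double_choose2[of k], of int] by simp
    moreover have "int (2 * n - k) = 2 * int n - int k"
      using k by auto
    moreover have "int (?p k) = int c * (int k - int n)\<^sup>2 + int d * (int k - int n)"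
      using abs_le_theta_exponent[OF \<open>d < c\<close>, of "int k - int n"] by linarith
    ultimately have "int (2 * c * (k choose 2) + 2 * c * n * (2 * n - k) + (c + d) * k) = int (M + ?p k)"
      unfolding M_def of_nat_add of_nat_mult by (simp only: of_nat_numeral) algebra
    then have "2 * c * (k choose 2) + 2 * c * n * (2 * n - k) + (c + d) * k = M + ?p k"
      by (simp only: of_nat_eq_iff)
    then have "q ^ (k choose 2) * ?a ^ (2 * n - k) * (fps_X ^ (c + d)) ^ k = fps_X ^ M * fps_X ^ ?p k"
      unfolding q_def power_mult[symmetric] power_add[symmetric] by simp
    then have *: "q ^ (k choose 2) * (?a ^ (2 * n - k) * (fps_X ^ (c + d)) ^ k) = fps_X ^ M * fps_X ^ ?p k"
      by (simp only: mult.assoc)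
    have "?c k * q ^ (k choose 2) * ?a ^ (2 * n - k) * ?b ^ k =
      ?c k * e ^ k * (q ^ (k choose 2) * (?a ^ (2 * n - k) * (fps_X ^ (c + d)) ^ k))"
      unfolding power_mult_distrib by (simp only: mult_ac)
    then show "?c k * q ^ (k choose 2) * ?a ^ (2 * n - k) * ?b ^ k = fps_X ^ M * (?c k * e ^ k * fps_X ^ ?p k)"
      unfolding * by (simp only: mult_ac)
  qed
  finally have "fps_X ^ M * (e ^ n * ?P) = fps_X ^ M * (\<Sum>k\<le>2 * n. ?c k * e ^ k * fps_X ^ ?p k)"
    unfolding sum_distrib_left by (simp only: mult_ac)
  then have "e ^ n * ?P = (\<Sum>k\<le>2 * n. ?c k * e ^ k * fps_X ^ ?p k)"
    by simp
  then have "(e ^ n * e ^ n) * ?P = (\<Sum>k\<le>2 * n. e ^ n * (?c k * e ^ k * fps_X ^ ?p k))"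
    by (simp only: mult.assoc[of "e ^ n" "e ^ n"] sum_distrib_left)
  moreover have "e ^ n * e ^ n = 1"
    by (simp add: e flip: power_mult_distrib)
  ultimately show ?thesis
    by (simp only: power_add[of e] mult_1_left mult_ac)
qed

text \<open>An index with exponent \<open>N\<close> satisfies \<open>|i| <= N\<close>, hence lies in
  the window from \<open>-n\<close> to \<open>n\<close> once \<open>N <= n\<close>. The signs agree
  since \<open>n + k\<close> and \<open>|k - n|\<close> have the same parity.\<close>

lemma tendsto_theta:
  fixes s :: int
  assumes "d < c" and s: "s * s = 1"
  shows "(\<lambda>n. \<Sum>k\<le>2 * n. fps_const s ^ (n + k) * fps_X ^ nat (int c * (int k - int n)\<^sup>2 + int d * (int k - int n)))
    \<longlonglongrightarrow> theta s c d"
proof (rule tendsto_fpsI)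
  fix N
  let ?p = "\<lambda>i. int c * i\<^sup>2 + int d * i"
  have "fps_nth (\<Sum>k\<le>2 * n. fps_const s ^ (n + k) * fps_X ^ nat (?p (int k - int n))) N = fps_nth (theta s c d) N"
    if "N \<le> n" for n
  proof -
    have "fps_nth (\<Sum>k\<le>2 * n. fps_const s ^ (n + k) * fps_X ^ nat (?p (int k - int n))) N
      = (\<Sum>k\<le>2 * n. if ?p (int k - int n) = int N then s ^ (n + k) else 0)"
      unfolding fps_sum_nth
    proof (rule sum.cong[OF refl])
      fix k
      have "?p (int k - int n) \<ge> 0"
        using abs_le_theta_exponent[OF \<open>d < c\<close>, of "int k - int n"] by linarith
      then have "N = nat (?p (int k - int n)) \<longleftrightarrow> ?p (int k - int n) = int N"
        by auto
      then show "fps_nth (fps_const s ^ (n + k) * fps_X ^ nat (?p (int k - int n))) N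
        = (if ?p (int k - int n) = int N then s ^ (n + k) else 0)"
        by (simp add: fps_const_power)
    qed
    also have "\<dots> = (\<Sum>k | k \<le> 2 * n \<and> ?p (int k - int n) = int N. s ^ (n + k))"
      by (simp add: sum.If_cases Collect_conj_eq atMost_def)
    also have "\<dots> = (\<Sum>i | ?p i = int N. s ^ nat \<bar>i\<bar>)"
    proof (rule sum.reindex_bij_witness[of _ "\<lambda>i. nat (i + int n)" "\<lambda>k. int k - int n"])
      fix i assume "i \<in> {i. ?p i = int N}"
      then have "\<bar>i\<bar> \<le> int N" "?p i = int N"
        using abs_le_theta_exponent[OF \<open>d < c\<close>, of i] by auto
      then show "int (nat (i + int n)) - int n = i" "nat (i + int n) \<in> {k. k \<le> 2 * n \<and> ?p (int k - int n) = int N}"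
        using that by auto
    next
      fix k assume k: "k \<in> {k. k \<le> 2 * n \<and> ?p (int k - int n) = int N}"
      have "s = 1 \<or> s = -1"
        using s by (metis square_eq_1_iff)
      moreover have "even (nat \<bar>int k - int n\<bar>) \<longleftrightarrow> even (n + k)"
        by (auto simp: even_nat_iff)
      ultimately show "s ^ nat \<bar>int k - int n\<bar> = s ^ (n + k)"
        by (auto simp: minus_one_power_iff)
    qed auto
    finally show ?thesis
      by (simp add: theta_def)
  qed
  then show "\<forall>\<^sub>F n in sequentially. fps_nth (\<Sum>k\<le>2 * n. fps_const s ^ (n + k) * fps_X ^ nat (?p (int k - int n))) N = fps_nth (theta s c d) N"
    unfolding eventually_sequentially by blast
qed

lemma tendsto_qinv_mult:
  assumes q: "fps_nth q 0 = 0" and "\<And>n. n \<le> f n"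
  shows "(\<lambda>n. qpoch_inf q q * qinv q (f n)) \<longlonglongrightarrow> 1"
proof (rule tendsto_fps_dvd)
  show "fps_X ^ n dvd qpoch_inf q q * qinv q (f n) - 1" for n
    by (rule power_le_dvd[OF qpoch_inf_qinv_dvd[OF q]]) (simp add: assms le_SucI)
qed simp

lemma jacobi_triple_product:
  fixes s :: int
  assumes "d < c" and s: "s * s = 1"
  shows "theta s c d = qpoch_inf (- (fps_const s * fps_X ^ (c + d))) (fps_X ^ (2 * c))
    * qpoch_inf (- (fps_const s * fps_X ^ (c - d))) (fps_X ^ (2 * c)) * qpoch_inf (fps_X ^ (2 * c)) (fps_X ^ (2 * c))"
proof -
  define q u v E where "q = (fps_X ^ (2 * c) :: int fps)" "u = - (fps_const s * fps_X ^ (c + d))"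
    "v = - (fps_const s * fps_X ^ (c - d))" "E = qpoch_inf q q"
  note defs = this
  have q: "fps_nth q 0 = 0" and u: "fps_nth u 0 = 0" and v: "fps_nth v 0 = 0"
    using \<open>d < c\<close> by (simp_all add: defs fps_X_power_nth)
  have e: "fps_const s * fps_const s = 1"
    by (simp add: s)
  let ?F = "\<lambda>n. E * E * (qpoch u q n * qpoch v q n * qinv q (2 * n))"
  have "?F \<longlonglongrightarrow> theta s c d"
  proof (rule tendsto_fps_dvd[OF _ tendsto_theta[OF assms]])
    fix n
    let ?p = "\<lambda>k. nat (int c * (int k - int n)\<^sup>2 + int d * (int k - int n))"
    let ?t = "\<lambda>k. fps_const s ^ (n + k) * fps_X ^ ?p k"
    have "?F n = (\<Sum>k\<le>2 * n. (E * qinv q k) * (E * qinv q (2 * n - k)) * ?t k)"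
      unfolding defs finite_jacobi_triple_product[OF \<open>d < c\<close> e] sum_distrib_left by (simp only: mult_ac)
    then have eq: "?F n - (\<Sum>k\<le>2 * n. ?t k) = (\<Sum>k\<le>2 * n. ((E * qinv q k) * (E * qinv q (2 * n - k)) - 1) * ?t k)"
      by (simp add: sum_subtractf left_diff_distrib)
    have dv: "fps_X ^ n dvd ((E * qinv q k) * (E * qinv q (2 * n - k)) - 1) * ?t k" if "k \<in> {..2 * n}" for k
    proof -
      define m where "m = min k (2 * n - k)"
      have "fps_X ^ m dvd E * qinv q k - 1" "fps_X ^ m dvd E * qinv q (2 * n - k) - 1"
        unfolding defs(4) by (rule power_le_dvd[OF qpoch_inf_qinv_dvd[OF q]], simp add: m_def)+
      then have "fps_X ^ m dvd (E * qinv q k - 1) * (E * qinv q (2 * n - k)) + (E * qinv q (2 * n - k) - 1)"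
        by (intro dvd_add dvd_mult2)
      then have "fps_X ^ m * fps_X ^ ?p k dvd ((E * qinv q k) * (E * qinv q (2 * n - k)) - 1) * ?t k"
        by (intro mult_dvd_mono) (simp_all add: algebra_simps)
      \<comment> \<open>Near the ends of the range the coefficient is far from its limit 1, but the
        theta exponent compensates: \<open>m = n - |k - n|\<close>, while
        \<open>?p k >= |k - n|\<close>.\<close>
      moreover have "n \<le> m + ?p k"
        using abs_le_theta_exponent[OF \<open>d < c\<close>, of "int k - int n"] that by (auto simp: m_def min_def)
      ultimately show ?thesis
        unfolding power_add[symmetric] by (rule power_le_dvd)
    qed
    show "fps_X ^ n dvd ?F n - (\<Sum>k\<le>2 * n. ?t k)"
      unfolding eq by (intro dvd_sum dv)
  qed
  moreover have "(\<lambda>n. qpoch u q n * qpoch v q n * E * (E * qinv q (2 * n))) \<longlonglongrightarrow> qpoch_inf u q * qpoch_inf v q * E * 1"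
    using tendsto_qinv_mult[OF q, of "\<lambda>n. 2 * n"]
    by (intro tendsto_fps_mult tendsto_qpoch u v q tendsto_const) (simp_all add: defs(4))
  then have "?F \<longlonglongrightarrow> qpoch_inf u q * qpoch_inf v q * E"
    by (simp add: mult_ac)
  ultimately have "theta s c d = qpoch_inf u q * qpoch_inf v q * E"
    by (rule LIMSEQ_unique)
  then show ?thesis
    by (simp only: defs)
qed

section \<open>Arithmetic progressions of coefficients\<close>

abbreviation dil :: "nat \<Rightarrow> int fps \<Rightarrow> int fps" where
  "dil m f \<equiv> f oo (fps_X ^ m)"

lemma dil_nth:
  assumes "m > 0"
  shows "fps_nth (dil m f) n = (if m dvd n then fps_nth f (n div m) else 0)"
proof -
  have "fps_nth (dil m f) n = (\<Sum>i\<in>{0..n}. if n = m * i then fps_nth f i else 0)"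
    by (auto simp: fps_compose_nth simp flip: power_mult intro!: sum.cong)
  also have "\<dots> = (\<Sum>i\<in>{0..n}. if i = n div m then (if m dvd n then fps_nth f i else 0) else 0)"
    using assms by (intro sum.cong) auto
  also have "\<dots> = (if m dvd n then fps_nth f (n div m) else 0)"
    by simp
  finally show ?thesis .
qed

lemma dil_mult: "m > 0 \<Longrightarrow> dil m (f * g) = dil m f * dil m g"
  by (rule fps_compose_mult_distrib) (simp add: fps_X_power_nth)

definition sect :: "nat \<Rightarrow> nat \<Rightarrow> int fps \<Rightarrow> int fps" where
  "sect m j f = Abs_fps (\<lambda>n. fps_nth f (m * n + j))"

lemma sect_nth [simp]: "fps_nth (sect m j f) n = fps_nth f (m * n + j)"
  by (simp add: sect_def)

lemma sect_add: "sect m j (f + g) = sect m j f + sect m j g"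
  by (simp add: fps_eq_iff)

lemma sect_sum: "sect m j (sum f A) = (\<Sum>a\<in>A. sect m j (f a))"
  by (simp add: fps_eq_iff fps_sum_nth)

lemma dvd_sect: "(of_int k :: int fps) dvd f \<Longrightarrow> of_int k dvd sect m j f"
proof -
  assume "of_int k dvd f"
  then obtain g where "f = of_int k * g" ..
  then have "sect m j f = of_int k * sect m j g"
    by (simp add: fps_eq_iff fps_of_int[symmetric])
  then show ?thesis
    by simp
qed

lemma tendsto_sect:
  assumes "F \<longlonglongrightarrow> f"
  shows "(\<lambda>n. sect m j (F n)) \<longlonglongrightarrow> sect m j f"
  using assms by (auto simp: tendsto_fps_iff)

text \<open>A factor that is a series in the \<open>m\<close>-th power of the variable does not mix
  residue classes of exponents modulo \<open>m\<close>.\<close>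

lemma sect_dil_mult:
  assumes "j < m"
  shows "sect m j (dil m f * g) = f * sect m j g"
proof (rule fps_ext)
  fix n
  have m: "m > 0"
    using assms by simp
  have "fps_nth (sect m j (dil m f * g)) n =
      (\<Sum>i\<in>{0..m * n + j}. if m dvd i then fps_nth f (i div m) * fps_nth g (m * n + j - i) else 0)"
    by (auto simp: fps_mult_nth dil_nth[OF m] intro!: sum.cong)
  also have "\<dots> = (\<Sum>i | i \<in> {0..m * n + j} \<and> m dvd i. fps_nth f (i div m) * fps_nth g (m * n + j - i))"
    by (rule sum.inter_filter[symmetric]) simp
  also have "\<dots> = (\<Sum>i\<in>{0..n}. fps_nth f i * fps_nth g (m * (n - i) + j))"
  proof (rule sum.reindex_bij_witness[of _ "\<lambda>i. m * i" "\<lambda>i. i div m"])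
    fix i assume i: "i \<in> {i. i \<in> {0..m * n + j} \<and> m dvd i}"
    then obtain k where k: "i = m * k"
      by auto
    then have "m * k < m * Suc n"
      using i assms by simp
    then have "k \<le> n"
      by (simp only: mult_less_cancel1 less_Suc_eq_le)
    then show "i div m \<in> {0..n}" "fps_nth f (i div m) * fps_nth g (m * (n - i div m) + j) = fps_nth f (i div m) * fps_nth g (m * n + j - i)"
      using m by (simp_all add: k diff_mult_distrib2)
  qed (use m in \<open>auto simp: trans_le_add1\<close>)
  also have "\<dots> = fps_nth (f * sect m j g) n"
    by (simp add: fps_mult_nth)
  finally show "fps_nth (sect m j (dil m f * g)) n = fps_nth (f * sect m j g) n" .
qed

lemma even_odd_decomposition: "f = dil 2 (sect 2 0 f) + fps_X * dil 2 (sect 2 1 f)"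
proof (rule fps_ext)
  fix n
  show "fps_nth f n = fps_nth (dil 2 (sect 2 0 f) + fps_X * dil 2 (sect 2 1 f)) n"
    by (cases n) (auto simp: dil_nth elim!: evenE oddE)
qed

text \<open>Even exponents arise as even plus even or odd plus odd. In the second case the two
  leftover units form a square of the variable, hence the single \<open>fps_X\<close> after
  halving.\<close>

lemma sect_even_mult:
  "sect 2 0 (f * g) = sect 2 0 f * sect 2 0 g + fps_X * (sect 2 1 f * sect 2 1 g)"
proof -
  have X: "sect 2 0 (fps_X * g) = fps_X * sect 2 1 g"
  proof (rule fps_ext)
    fix n
    show "fps_nth (sect 2 0 (fps_X * g)) n = fps_nth (fps_X * sect 2 1 g) n"
      by (cases n) simp_all
  qed
  have "f * g = dil 2 (sect 2 0 f) * g + dil 2 (sect 2 1 f) * (fps_X * g)"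
    by (subst even_odd_decomposition[of f]) (simp add: algebra_simps)
  then have "sect 2 0 (f * g) = sect 2 0 f * sect 2 0 g + sect 2 1 f * sect 2 0 (fps_X * g)"
    by (simp add: sect_add sect_dil_mult)
  then show ?thesis
    by (simp add: X mult_ac)
qed

section \<open>Dissections of theta series and congruences modulo 4\<close>

lemma dil_theta: "dil 2 (theta s c d) = theta s (2 * c) (2 * d)"
proof (rule fps_ext)
  fix n
  show "fps_nth (dil 2 (theta s c d)) n = fps_nth (theta s (2 * c) (2 * d)) n"
  proof (cases "even n")
    case True
    then obtain k where k: "n = 2 * k" ..
    have "2 * int c * i\<^sup>2 + 2 * int d * i = 2 * int k \<longleftrightarrow> int c * i\<^sup>2 + int d * i = int k" for i
      by (auto simp: algebra_simps)
    then show ?thesis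
      by (simp add: dil_nth k theta_def)
  next
    case False
    have "2 * int c * i\<^sup>2 + 2 * int d * i \<noteq> int n" for i
    proof
      assume *: "2 * int c * i\<^sup>2 + 2 * int d * i = int n"
      have "even (int n)"
        unfolding *[symmetric] by simp
      with False show "False"
        by simp
    qed
    then show ?thesis
      using False by (simp add: dil_nth theta_def)
  qed
qed

text \<open>The exponent \<open>3 * i^2 + 2 * i\<close> is odd exactly for odd \<open>i\<close>, and
  \<open>i = - 2 * j - 1\<close> turns it into \<open>4 * (3 * j^2 + 2 * j) + 1\<close>. This
  self-similarity is what makes the final congruence relate a series to its own section.\<close>

lemma sect_theta_3_2: "sect 2 1 (theta 1 3 2) = dil 2 (theta 1 3 2)"
proof -
  have "sect 2 1 (theta 1 3 2) = theta 1 (2 * 3) (2 * 2)"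
  proof (rule fps_ext)
    fix n
    have "card {i::int. 3 * i\<^sup>2 + 2 * i = 2 * int n + 1} = card {i::int. 6 * i\<^sup>2 + 4 * i = int n}"
    proof (rule bij_betw_same_card[OF bij_betw_byWitness[where f = "\<lambda>i. - ((i + 1) div 2)" and f' = "\<lambda>j. - 2 * j - 1"]])
      have odd: "\<exists>j. i = - 2 * j - 1" if "3 * i\<^sup>2 + 2 * i = 2 * int n + 1" for i :: int
      proof -
        have "odd (3 * i\<^sup>2 + 2 * i)"
          unfolding that by simp
        then have "odd i"
          by simp
        then obtain k where "i = 2 * k + 1" ..
        then have "i = - 2 * (- k - 1) - 1"
          by simp
        then show ?thesis ..
      qed
      show "\<forall>i\<in>{i::int. 3 * i\<^sup>2 + 2 * i = 2 * int n + 1}. - 2 * (- ((i + 1) div 2)) - 1 = i"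
        by (auto dest!: odd)
      show "(\<lambda>i. - ((i + 1) div 2)) ` {i::int. 3 * i\<^sup>2 + 2 * i = 2 * int n + 1} \<subseteq> {i::int. 6 * i\<^sup>2 + 4 * i = int n}"
      proof safe
        fix i :: int assume i: "3 * i\<^sup>2 + 2 * i = 2 * int n + 1"
        then obtain j where j: "i = - 2 * j - 1"
          using odd by blast
        have "6 * j\<^sup>2 + 4 * j = int n"
          using i unfolding j by (simp add: power2_eq_square algebra_simps)
        moreover have "i + 1 = 2 * (- j)"
          using j by simp
        then have "(i + 1) div 2 = - j"
          by simp
        ultimately show "6 * (- ((i + 1) div 2))\<^sup>2 + 4 * - ((i + 1) div 2) = int n"
          by simp
      qed
    qed (auto simp: power2_eq_square algebra_simps)
    then show "fps_nth (sect 2 1 (theta 1 3 2)) n = fps_nth (theta 1 (2 * 3) (2 * 2)) n"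
      by (simp add: theta_def add.commute)
  qed
  then show ?thesis
    by (simp only: dil_theta)
qed

text \<open>For odd \<open>c\<close> only even indices \<open>i = 2 * j\<close> remain, and the sign
  attached to them is a power of \<open>s * s\<close>.\<close>

lemma sect_even_theta:
  assumes "odd c"
  shows "sect 2 0 (theta s c 0) = theta (s * s) (2 * c) 0"
proof (rule fps_ext)
  fix n
  have "(\<Sum>i | int c * i\<^sup>2 = 2 * int n. s ^ nat \<bar>i\<bar>) = (\<Sum>j | 2 * int c * j\<^sup>2 = int n. (s * s) ^ nat \<bar>j\<bar>)"
  proof (rule sum.reindex_bij_witness[of _ "\<lambda>j. 2 * j" "\<lambda>i. i div 2"])
    fix i :: int assume i: "i \<in> {i. int c * i\<^sup>2 = 2 * int n}"
    then have "even (int c * i\<^sup>2)"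
      by simp
    then have "even i"
      using assms by simp
    then obtain j where j: "i = 2 * j" ..
    have "2 * int c * j\<^sup>2 = int n"
      using i by (simp add: j power2_eq_square algebra_simps)
    then show "2 * (i div 2) = i" "i div 2 \<in> {j. 2 * int c * j\<^sup>2 = int n}"
      by (simp_all add: j)
    have "nat \<bar>i\<bar> = 2 * nat \<bar>j\<bar>"
      by (simp add: j abs_mult nat_mult_distrib)
    then show "(s * s) ^ nat \<bar>i div 2\<bar> = s ^ nat \<bar>i\<bar>"
      by (simp add: j power_mult power2_eq_square)
  qed (auto simp: power2_eq_square algebra_simps)
  then show "fps_nth (sect 2 0 (theta s c 0)) n = fps_nth (theta (s * s) (2 * c) 0) n"
    by (simp add: theta_def)
qed

definition theta_half :: "int \<Rightarrow> nat \<Rightarrow> int fps" where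
  "theta_half s c = Abs_fps (\<lambda>n. \<Sum>i | 0 < i \<and> int c * i\<^sup>2 = int n. s ^ nat i)"

text \<open>Without a linear term \<open>i\<close> and \<open>- i\<close> contribute equally, which
  leaves \<open>i = 0\<close> as the only unpaired index.\<close>

lemma theta_0_eq:
  assumes "c > 0"
  shows "theta s c 0 = 1 + 2 * theta_half s c"
proof (rule fps_ext)
  fix n
  have fin: "finite {i. int c * i\<^sup>2 = int n}"
    using finite_theta_indices[of 0 c n] assms by simp
  have split: "{i. int c * i\<^sup>2 = int n} = {i. 0 < i \<and> int c * i\<^sup>2 = int n} \<union>
     ({i. i < 0 \<and> int c * i\<^sup>2 = int n} \<union> (if n = 0 then {0} else {}))"
  proof (rule set_eqI)
    show "i \<in> {i. int c * i\<^sup>2 = int n} \<longleftrightarrow> i \<in> {i. 0 < i \<and> int c * i\<^sup>2 = int n} \<union>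
     ({i. i < 0 \<and> int c * i\<^sup>2 = int n} \<union> (if n = 0 then {0} else {}))" for i
      by (cases i "0::int" rule: linorder_cases) (use assms in auto)
  qed
  have "(\<Sum>i | i < 0 \<and> int c * i\<^sup>2 = int n. s ^ nat \<bar>i\<bar>) = (\<Sum>i | 0 < i \<and> int c * i\<^sup>2 = int n. s ^ nat i)"
    by (rule sum.reindex_bij_witness[of _ uminus uminus]) auto
  moreover have "(\<Sum>i | 0 < i \<and> int c * i\<^sup>2 = int n. s ^ nat \<bar>i\<bar>) = (\<Sum>i | 0 < i \<and> int c * i\<^sup>2 = int n. s ^ nat i)"
    by (rule sum.cong) auto
  moreover have "(\<Sum>i | int c * i\<^sup>2 = int n. s ^ nat \<bar>i\<bar>) = (\<Sum>i | 0 < i \<and> int c * i\<^sup>2 = int n. s ^ nat \<bar>i\<bar>) +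
     ((\<Sum>i | i < 0 \<and> int c * i\<^sup>2 = int n. s ^ nat \<bar>i\<bar>) + (\<Sum>i\<in>(if n = 0 then {0} else {}). s ^ nat \<bar>i\<bar>))"
    unfolding split
    by (subst sum.union_disjoint sum.union_disjoint; use fin in \<open>auto intro: finite_subset[OF _ fin]\<close>)+
  ultimately show "fps_nth (theta s c 0) n = fps_nth (1 + 2 * theta_half s c) n"
    by (simp add: theta_def theta_half_def fps_numeral_nth numeral_fps_const)
qed

lemma theta_0_square: "c > 0 \<Longrightarrow> 4 dvd theta s c 0 * theta s c 0 - 1"
proof -
  assume c: "c > 0"
  have "theta s c 0 * theta s c 0 - 1 = 4 * (theta_half s c + theta_half s c * theta_half s c)"
    unfolding theta_0_eq[OF c] by (simp add: algebra_simps)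
  then show ?thesis
    by simp
qed

text \<open>Changing the sign of a term alters it by 0 or 2, and the pairing of \<open>i\<close>
  with \<open>- i\<close> doubles the change.\<close>

lemma theta_0_sign: "c > 0 \<Longrightarrow> 4 dvd theta 1 c 0 - theta (-1) c 0"
proof -
  assume c: "c > 0"
  define h where "h = Abs_fps (\<lambda>n. \<Sum>i | 0 < i \<and> int c * i\<^sup>2 = int n. of_bool (odd (nat i)) :: int)"
  have "theta_half 1 c - theta_half (-1) c = 2 * h"
  proof (rule fps_ext)
    fix n
    have "fps_nth (theta_half 1 c - theta_half (-1) c) n = (\<Sum>i | 0 < i \<and> int c * i\<^sup>2 = int n. 1 - (-1) ^ nat i)"
      by (simp add: theta_half_def sum_subtractf)
    also have "\<dots> = (\<Sum>i | 0 < i \<and> int c * i\<^sup>2 = int n. 2 * of_bool (odd (nat i)))"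
      by (intro sum.cong) (auto simp: minus_one_power_iff)
    also have "\<dots> = fps_nth (2 * h) n"
      by (simp add: h_def sum_distrib_left numeral_fps_const)
    finally show "fps_nth (theta_half 1 c - theta_half (-1) c) n = fps_nth (2 * h) n" .
  qed
  moreover have "theta 1 c 0 - theta (-1) c 0 = 2 * (theta_half 1 c - theta_half (-1) c)"
    unfolding theta_0_eq[OF c] by (simp add: algebra_simps)
  ultimately have "theta 1 c 0 - theta (-1) c 0 = 4 * h"
    by simp
  then show ?thesis
    by simp
qed

lemma dvd_sect_theta_0:
  assumes "c > 0"
  shows "2 dvd sect 2 1 (theta s c 0)"
proof -
  have "theta s c 0 = 1 + 2 * theta_half s c"
    by (rule theta_0_eq[OF assms])
  then have "sect 2 1 (theta s c 0) = 2 * sect 2 1 (theta_half s c)"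
    by (simp add: fps_eq_iff numeral_fps_const)
  then show ?thesis
    by simp
qed

text \<open>The quotient is first turned into the product \<open>T * (P * R)\<close> modulo 4. The
  section is then taken in two halvings: in the first \<open>P * R\<close> passes through as a
  series in the square of the variable, in the second the section of \<open>T\<close> does.\<close>

lemma sect_theta_quotient_cong:
  assumes F: "F * theta (-1) 2 0 = theta (-1) 6 0 * theta 1 3 2"
  shows "4 dvd sect 4 1 F - F"
proof -
  define T P R where "T = theta 1 3 2" "P = theta (-1) 2 0" "R = theta (-1) 6 0"
  note defs = this
  define K where "K = theta (-1) 1 0 * theta (-1) 3 0"
  have K: "dil 2 K = P * R"
    using dil_theta[of "-1" 1 0] dil_theta[of "-1" 3 0] by (simp add: K_def dil_mult defs)
  have "T * (P * R) - F = F * (P * P - 1)"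
    using F by (simp add: defs algebra_simps)
  then have F4: "4 dvd T * (P * R) - F"
    using theta_0_square[of 2 "-1"] by (simp add: defs)
  have "4 dvd sect 2 1 (T * dil 2 K - F)"
    using dvd_sect[of 4 "T * dil 2 K - F"] F4 by (simp add: K)
  moreover have "sect 2 1 (T * dil 2 K - F) = K * dil 2 T - sect 2 1 F"
  proof -
    have "sect 2 1 (dil 2 K * T) = K * sect 2 1 T"
      by (rule sect_dil_mult) simp
    also have "\<dots> = K * dil 2 T"
      by (simp only: sect_theta_3_2 defs)
    finally have "sect 2 1 (dil 2 K * T) = K * dil 2 T" .
    then show ?thesis
      by (simp add: fps_eq_iff mult.commute)
  qed
  ultimately have "4 dvd sect 2 0 (K * dil 2 T - sect 2 1 F)"
    using dvd_sect[of 4 "K * dil 2 T - sect 2 1 F"] by simp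
  \<comment> \<open>Here \<open>4 * n + 1 = 2 * (2 * n) + 1\<close>, so the even section after the
    odd one is \<open>sect 4 1\<close>.\<close>
  moreover have "sect 2 0 (K * dil 2 T - sect 2 1 F) = T * sect 2 0 K - sect 4 1 F"
  proof -
    have "sect 2 0 (dil 2 T * K) = T * sect 2 0 K"
      by (rule sect_dil_mult) simp
    then show ?thesis
      by (simp add: fps_eq_iff mult.commute)
  qed
  ultimately have 1: "4 dvd T * sect 2 0 K - sect 4 1 F"
    by simp
  have "sect 2 0 K = theta 1 2 0 * theta 1 6 0 + fps_X * (sect 2 1 (theta (-1) 1 0) * sect 2 1 (theta (-1) 3 0))"
    unfolding K_def sect_even_mult by (simp add: sect_even_theta)
  then have "sect 2 0 K - P * R = (theta 1 2 0 - P) * theta 1 6 0 + P * (theta 1 6 0 - R) +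
     fps_X * (sect 2 1 (theta (-1) 1 0) * sect 2 1 (theta (-1) 3 0))"
    by (simp add: algebra_simps)
  \<comment> \<open>The product of the odd parts disappears modulo 4, since each of them is
    even.\<close>
  moreover have "2 * 2 dvd sect 2 1 (theta (-1) 1 0) * sect 2 1 (theta (-1) 3 0)"
    by (intro mult_dvd_mono dvd_sect_theta_0) simp_all
  ultimately have "4 dvd sect 2 0 K - P * R"
    using theta_0_sign[of 2] theta_0_sign[of 6] by (simp add: defs)
  then have "4 dvd T * (sect 2 0 K - P * R)"
    by (rule dvd_mult)
  then have "4 dvd (T * (P * R) - F) + T * (sect 2 0 K - P * R) - (T * sect 2 0 K - sect 4 1 F)"
    by (rule dvd_diff[OF dvd_add[OF F4] 1])
  then show ?thesis
    by (simp add: algebra_simps)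
qed

section \<open>Dissection of the series\<close>

lemma dil_qpoch_inf:
  assumes "m > 0" "fps_nth a 0 = 0" "fps_nth q 0 = 0"
  shows "dil m (qpoch_inf a q) = qpoch_inf (dil m a) (dil m q)"
proof (rule LIMSEQ_unique)
  have X: "fps_nth ((fps_X :: int fps) ^ m) 0 = 0"
    using assms(1) by (simp add: fps_X_power_nth)
  have eq: "dil m (qpoch a q n) = qpoch (dil m a) (dil m q) n" for n
    unfolding qpoch_def
    by (simp add: fps_compose_prod_distrib[OF X] fps_compose_sub_distrib fps_compose_mult_distrib[OF X] fps_compose_power[OF X])
  show "(\<lambda>n. dil m (qpoch a q n)) \<longlonglongrightarrow> dil m (qpoch_inf a q)"
    using tendsto_qpoch[OF assms(2,3)] by (auto simp: tendsto_fps_iff dil_nth[OF assms(1)])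
  show "(\<lambda>n. dil m (qpoch a q n)) \<longlonglongrightarrow> qpoch_inf (dil m a) (dil m q)"
    unfolding eq using assms by (intro tendsto_qpoch) (simp_all add: dil_nth)
qed

lemma finv_one_minus_X_power:
  assumes "a > 0"
  shows "finv (1 - fps_X ^ a) = Abs_fps (\<lambda>n. of_bool (a dvd n))"
proof (rule finv_unique[symmetric])
  show "(1 - fps_X ^ a) * Abs_fps (\<lambda>n. of_bool (a dvd n)) = (1 :: int fps)"
    using assms
    by (auto simp: fps_eq_iff left_diff_distrib fps_X_power_mult_nth dvd_minus_self dest: dvd_imp_le)
qed (use assms in \<open>simp add: fps_X_power_nth\<close>)

text \<open>Since \<open>Y\<close> equals \<open>1 / (1 - q^a) + q^b / (1 - q^b)\<close>, its
  coefficients only record divisibility of the exponent by \<open>a\<close> and \<open>b\<close>.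
  Replacing \<open>n\<close> by \<open>3 * n\<close> does not affect this when both are coprime to
  3.\<close>

lemma sect_lambert:
  assumes "a > 0" "b > 0" "coprime a 3" "coprime b 3"
  defines "Y \<equiv> (1 - fps_X ^ (a + b)) * finv ((1 - fps_X ^ a) * (1 - fps_X ^ b))"
  shows "sect 3 1 (fps_X * Y) = Y"
proof -
  have nth0: "fps_nth (1 - (fps_X :: int fps) ^ k) 0 = 1" if "k > 0" for k
    using that by (simp add: fps_X_power_nth)
  let ?A = "1 - (fps_X :: int fps) ^ a" and ?B = "1 - (fps_X :: int fps) ^ b"
  have "1 - fps_X ^ (a + b) = ?B + fps_X ^ b * ?A"
    by (simp add: power_add algebra_simps)
  then have "Y = (?B + fps_X ^ b * ?A) * (finv ?A * finv ?B)"
    using assms(1,2) by (simp add: Y_def finv_mult nth0)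
  also have "\<dots> = finv ?A * (?B * finv ?B) + fps_X ^ b * finv ?B * (?A * finv ?A)"
    by (simp add: algebra_simps)
  also have "\<dots> = finv ?A + fps_X ^ b * finv ?B"
    using assms(1,2) by (simp only: finv[OF nth0] mult_1_right)
  finally have Y: "fps_nth Y n = of_bool (a dvd n) + of_bool (b dvd n \<and> n > 0)" for n
    using assms(1,2)
    by (auto simp: finv_one_minus_X_power fps_X_power_mult_nth dvd_minus_self dest: dvd_imp_le)
  show ?thesis
    using assms(3,4) by (simp add: fps_eq_iff Y coprime_dvd_mult_right_iff)
qed

section \<open>From the series to a product\<close>

definition xi_sum :: "int fps" where
  "xi_sum = (\<Sum>n. xi_term (Suc n))"

definition lambert_term :: "nat \<Rightarrow> int fps" where
  "lambert_term r = (1 - fps_X ^ (12 * r + 6)) * finv ((1 - fps_X ^ (6 * r + 1)) * (1 - fps_X ^ (6 * r + 5)))"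

abbreviation E6 :: "int fps" where
  "E6 \<equiv> qpoch_inf (fps_X ^ 6) (fps_X ^ 6)"

lemma finv_xi_denom:
  "finv (xi_denom (Suc n)) = (\<Sum>r\<le>n. (-1) ^ r * (fps_X ^ 6) ^ (Suc r choose 2) * qinv (fps_X ^ 6) (n - r) *
     qinv (fps_X ^ 6) (n + 1 + r) * lambert_term r)"
proof -
  have "finv (xi_denom (Suc n)) = (\<Sum>r\<le>n. (-1) ^ r * (fps_X ^ 6) ^ (Suc r choose 2) * (1 - (fps_X ^ 6) ^ (2 * r + 1)) *
     qinv (fps_X ^ 6) (n - r) * qinv (fps_X ^ 6) (n + 1 + r) *
     finv ((1 - fps_X * (fps_X ^ 6) ^ r) * (1 - fps_X ^ 5 * (fps_X ^ 6) ^ r)))"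
    unfolding xi_denom_def
    by (rule partial_fractions_qpoch) (simp_all add: fps_X_power_nth flip: power_Suc)
  also have "\<dots> = (\<Sum>r\<le>n. (-1) ^ r * (fps_X ^ 6) ^ (Suc r choose 2) * qinv (fps_X ^ 6) (n - r) *
     qinv (fps_X ^ 6) (n + 1 + r) * lambert_term r)"
  proof (rule sum.cong[OF refl])
    fix r
    have e: "(fps_X ^ 6) ^ (2 * r + 1) = (fps_X :: int fps) ^ (12 * r + 6)"
      "fps_X * (fps_X ^ 6) ^ r = (fps_X :: int fps) ^ (6 * r + 1)"
      "fps_X ^ 5 * (fps_X ^ 6) ^ r = (fps_X :: int fps) ^ (6 * r + 5)"
      by (simp_all add: algebra_simps flip: power_mult power_add)
    show "(-1) ^ r * (fps_X ^ 6) ^ (Suc r choose 2) * (1 - (fps_X ^ 6) ^ (2 * r + 1)) *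
     qinv (fps_X ^ 6) (n - r) * qinv (fps_X ^ 6) (n + 1 + r) *
     finv ((1 - fps_X * (fps_X ^ 6) ^ r) * (1 - fps_X ^ 5 * (fps_X ^ 6) ^ r)) =
      (-1) ^ r * (fps_X ^ 6) ^ (Suc r choose 2) * qinv (fps_X ^ 6) (n - r) * qinv (fps_X ^ 6) (n + 1 + r) * lambert_term r"
      unfolding e lambert_term_def by (simp only: mult_ac)
  qed
  finally show ?thesis .
qed

lemma le_choose2: "r \<le> Suc r choose 2"
  by (simp add: choose2_Suc)

text \<open>With \<open>n = r + m\<close> one has
  \<open>n * (n + 1) = r * (r + 1) + m * (m + (2 * r + 1))\<close>, so for fixed \<open>r\<close>
  the sum over \<open>m\<close> is a Durfee sum with \<open>k = 2 * r + 1\<close>. Cutting it at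
  \<open>M - r\<close> suffices because \<open>c r\<close> has order at least
  \<open>r\<close>.\<close>

lemma E6_xi_sum_dvd:
  "fps_X ^ M dvd E6 * (\<Sum>n<M. xi_term (Suc n)) -
    (\<Sum>r<M. fps_X * ((-1) ^ r * (fps_X ^ 6) ^ ((Suc r choose 2) + r * (r + 1)) * lambert_term r))"
proof -
  define Q where "Q = (fps_X :: int fps) ^ 6"
  define c where "c = (\<lambda>r. fps_X * ((-1) ^ r * Q ^ ((Suc r choose 2) + r * (r + 1)) * lambert_term r))"
  define g where "g = (\<lambda>r m. Q ^ (m * (m + (2 * r + 1))) * qinv Q m * qinv Q (m + (2 * r + 1)))"
  have Q: "fps_nth Q 0 = 0"
    by (simp add: Q_def)
  have xi_term_eq: "xi_term (Suc n) = (\<Sum>r\<le>n. c r * g r (n - r))" for n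
  proof -
    have "6 * Suc n ^ 2 - 6 * Suc n + 1 = Suc (6 * (n * (n + 1)))"
      by (simp add: power2_eq_square)
    then have "xi_term (Suc n) = fps_X * Q ^ (n * (n + 1)) * finv (xi_denom (Suc n))"
      by (simp only: xi_term_def Q_def power_mult power_Suc)
    also have "\<dots> = (\<Sum>r\<le>n. c r * g r (n - r))"
      unfolding finv_xi_denom sum_distrib_left
    proof (rule sum.cong[OF refl])
      fix r assume "r \<in> {..n}"
      then obtain m where n: "n = r + m"
        using le_Suc_ex by auto
      have "n * (n + 1) = r * (r + 1) + m * (m + (2 * r + 1))"
        by (simp add: n algebra_simps)
      then have e: "Q ^ (n * (n + 1)) = Q ^ (r * (r + 1)) * Q ^ (m * (m + (2 * r + 1)))"
        by (simp only: power_add)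
      have "n + 1 + r = m + (2 * r + 1)" "n - r = m"
        by (simp_all add: n)
      then show "fps_X * Q ^ (n * (n + 1)) * ((-1) ^ r * (fps_X ^ 6) ^ (Suc r choose 2) * qinv (fps_X ^ 6) (n - r) *
          qinv (fps_X ^ 6) (n + 1 + r) * lambert_term r) = c r * g r (n - r)"
        unfolding Q_def[symmetric] e c_def g_def power_add[of Q "Suc r choose 2"] by (simp only: mult_ac)
    qed
    finally show ?thesis .
  qed
  have "(\<Sum>n<M. xi_term (Suc n)) = (\<Sum>r<M. c r * (\<Sum>m<M - r. g r m))"
  proof -
    have "(\<Sum>n<M. xi_term (Suc n)) = (\<Sum>(n, r)\<in>(SIGMA n:{..<M}. {..n}). c r * g r (n - r))"
      unfolding xi_term_eq by (simp add: sum.Sigma)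
    also have "\<dots> = (\<Sum>(r, m)\<in>(SIGMA r:{..<M}. {..<M - r}). c r * g r m)"
      by (rule sum.reindex_bij_witness[of _ "\<lambda>(r, m). (r + m, r)" "\<lambda>(n, r). (r, n - r)"]) auto
    finally show ?thesis
      by (simp add: sum.Sigma sum_distrib_left)
  qed
  then have eq: "E6 * (\<Sum>n<M. xi_term (Suc n)) - (\<Sum>r<M. c r) = (\<Sum>r<M. c r * (qpoch_inf Q Q * (\<Sum>m<M - r. g r m) - 1))"
    by (simp add: Q_def sum_distrib_left[of E6] sum_subtractf right_diff_distrib mult.left_commute)
  have "fps_X ^ M dvd c r * (qpoch_inf Q Q * (\<Sum>m<M - r. g r m) - 1)" if "r < M" for r
  proof -
    have "fps_X ^ r dvd Q ^ ((Suc r choose 2) + r * (r + 1))"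
      using le_choose2[of r] by (intro fps_X_power_dvd_power Q) simp
    then have "fps_X ^ r dvd c r"
      unfolding c_def by (intro dvd_mult dvd_mult2)
    moreover have "fps_X ^ (M - r) dvd qpoch_inf Q Q * (\<Sum>m<M - r. g r m) - 1"
      unfolding g_def by (rule durfee_rectangle_dvd[OF Q])
    ultimately have "fps_X ^ r * fps_X ^ (M - r) dvd c r * (qpoch_inf Q Q * (\<Sum>m<M - r. g r m) - 1)"
      by (rule mult_dvd_mono)
    then show ?thesis
      using that by (simp flip: power_add)
  qed
  then have "fps_X ^ M dvd E6 * (\<Sum>n<M. xi_term (Suc n)) - (\<Sum>r<M. c r)"
    unfolding eq by (intro dvd_sum) simp
  then show ?thesis
    by (simp only: c_def Q_def)
qed

text \<open>As \<open>r * (r + 1)\<close> is twice the binomial coefficient, the monomial in front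
  is the cube of \<open>(fps_X ^ 6) ^ (Suc r choose 2)\<close>. It therefore passes through the
  section and comes out as the monomial of the partial fraction expansion.\<close>

lemma sect_lambert_term:
  "sect 3 1 (fps_X * ((-1) ^ r * (fps_X ^ 6) ^ ((Suc r choose 2) + r * (r + 1)) * lambert_term r)) =
    (-1) ^ r * (fps_X ^ 6) ^ (Suc r choose 2) * lambert_term r"
proof -
  define p where "p = 2 * ((Suc r choose 2) + r * (r + 1))"
  have "2 * (Suc r choose 2) = r * (r + 1)"
    using double_choose2[of "Suc r"] by simp
  then have p: "p = 6 * (Suc r choose 2)"
    unfolding p_def by simp
  have X: "fps_nth ((fps_X :: int fps) ^ 3) 0 = 0"
    by simp
  have sgn: "dil 3 ((-1) ^ r) = (-1) ^ r"
    by (cases "even r") (simp_all add: fps_compose_uminus)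
  have "dil 3 ((-1) ^ r * fps_X ^ p) = (-1) ^ r * (fps_X ^ 3) ^ p"
    unfolding fps_compose_mult_distrib[OF X] sgn fps_X_power_compose[OF X] ..
  then have "fps_X * ((-1) ^ r * (fps_X ^ 6) ^ ((Suc r choose 2) + r * (r + 1)) * lambert_term r)
    = dil 3 ((-1) ^ r * fps_X ^ p) * (fps_X * lambert_term r)"
    by (simp add: p_def mult_ac flip: power_mult)
  then have "sect 3 1 (fps_X * ((-1) ^ r * (fps_X ^ 6) ^ ((Suc r choose 2) + r * (r + 1)) * lambert_term r))
    = ((-1) ^ r * fps_X ^ p) * sect 3 1 (fps_X * lambert_term r)"
    by (simp only: sect_dil_mult)
  also have "sect 3 1 (fps_X * lambert_term r) = lambert_term r"
  proof -
    have "coprime (6 * r + 1) 3"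
    proof (rule coprimeI)
      fix d assume d: "d dvd 6 * r + 1" "d dvd 3"
      have "d dvd 3 * (2 * r)"
        using d(2) by (rule dvd_mult2)
      moreover have "3 * (2 * r) + 1 = 6 * r + 1"
        by simp
      ultimately show "is_unit d"
        using d(1) by (metis dvd_add_right_iff)
    qed
    moreover have "coprime (6 * r + 5) 3"
    proof (rule coprimeI)
      fix d assume d: "d dvd 6 * r + 5" "d dvd 3"
      have "d dvd 3 * (2 * r + 2)"
        using d(2) by (rule dvd_mult2)
      moreover have "3 * (2 * r + 2) = (6 * r + 5) + 1"
        by simp
      ultimately show "is_unit d"
        using d(1) by (metis dvd_add_right_iff)
    qed
    moreover have "(6 * r + 1) + (6 * r + 5) = 12 * r + 6"
      by simp
    ultimately show ?thesis
      using sect_lambert[of "6 * r + 1" "6 * r + 5"] unfolding lambert_term_def by (simp only:)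
  qed
  finally show ?thesis
    by (simp add: p power_mult)
qed

text \<open>\<open>E6\<close> is a series in the cube of the variable and leaves the section as
  \<open>(q^2;q^2)_inf\<close>. The remaining sum of the \<open>L r\<close> is also the limit of
  \<open>E6 * E6\<close> times the partial fractions of \<open>1 / xi_denom (n + 1)\<close>, since
  both \<open>qinv\<close> factors there tend to the reciprocal of \<open>E6\<close>.\<close>

lemma sect_xi_sum_product:
  "qpoch_inf (fps_X ^ 2) (fps_X ^ 2) * sect 3 1 xi_sum * (qpoch_inf fps_X (fps_X ^ 6) * qpoch_inf (fps_X ^ 5) (fps_X ^ 6)) = E6 * E6"
proof -
  define L where "L = (\<lambda>r. (-1) ^ r * (fps_X ^ 6) ^ (Suc r choose 2) * lambert_term r)"
  have E6: "E6 = dil 3 (qpoch_inf (fps_X ^ 2) (fps_X ^ 2))"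
    by (subst dil_qpoch_inf) (simp_all add: fps_X_power_compose flip: power_mult)
  have "(\<lambda>M. \<Sum>n<M. xi_term (Suc n)) \<longlonglongrightarrow> xi_sum"
    unfolding xi_sum_def by (rule summable_LIMSEQ[OF summable_xi_term])
  then have "(\<lambda>M. E6 * (\<Sum>n<M. xi_term (Suc n))) \<longlonglongrightarrow> E6 * xi_sum"
    by (intro tendsto_fps_mult tendsto_const)
  then have "(\<lambda>M. \<Sum>r<M. fps_X * ((-1) ^ r * (fps_X ^ 6) ^ ((Suc r choose 2) + r * (r + 1)) * lambert_term r)) \<longlonglongrightarrow> E6 * xi_sum"
    by (rule tendsto_fps_dvd[rotated]) (subst dvd_minus_iff[symmetric], simp only: minus_diff_eq E6_xi_sum_dvd)
  then have "(\<lambda>M. sect 3 1 (\<Sum>r<M. fps_X * ((-1) ^ r * (fps_X ^ 6) ^ ((Suc r choose 2) + r * (r + 1)) * lambert_term r)))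
     \<longlonglongrightarrow> sect 3 1 (E6 * xi_sum)"
    by (rule tendsto_sect)
  then have "(\<lambda>M. \<Sum>r<M. L r) \<longlonglongrightarrow> qpoch_inf (fps_X ^ 2) (fps_X ^ 2) * sect 3 1 xi_sum"
    unfolding sect_sum sect_lambert_term L_def E6 by (simp add: sect_dil_mult)
  then have "(\<lambda>n. \<Sum>r<Suc n. L r) \<longlonglongrightarrow> qpoch_inf (fps_X ^ 2) (fps_X ^ 2) * sect 3 1 xi_sum"
    by (rule LIMSEQ_Suc)
  moreover have "fps_X ^ n dvd E6 * E6 * finv (xi_denom (Suc n)) - (\<Sum>r<Suc n. L r)" for n
  proof -
    define Q where "Q = (fps_X :: int fps) ^ 6"
    have Q: "fps_nth Q 0 = 0"
      by (simp add: Q_def)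
    define h where "h = (\<lambda>r. (E6 * qinv Q (n - r)) * (E6 * qinv Q (n + 1 + r)) - 1)"
    have "E6 * E6 * finv (xi_denom (Suc n)) = (\<Sum>r\<le>n. L r * (h r + 1))"
      unfolding finv_xi_denom sum_distrib_left h_def L_def Q_def by (rule sum.cong) (simp_all add: mult_ac)
    then have eq: "E6 * E6 * finv (xi_denom (Suc n)) - (\<Sum>r<Suc n. L r) = (\<Sum>r\<le>n. L r * h r)"
      by (simp add: distrib_left sum.distrib lessThan_Suc_atMost del: sum.lessThan_Suc)
    have "fps_X ^ n dvd L r * h r" if "r \<le> n" for r
    proof -
      have 1: "fps_X ^ (n - r) dvd E6 * qinv Q (n - r) - 1" "fps_X ^ (n - r) dvd E6 * qinv Q (n + 1 + r) - 1"
        unfolding Q_def[symmetric] by (rule power_le_dvd[OF qpoch_inf_qinv_dvd[OF Q]], simp)+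
      have "h r = (E6 * qinv Q (n - r) - 1) * (E6 * qinv Q (n + 1 + r)) + (E6 * qinv Q (n + 1 + r) - 1)"
        by (simp add: h_def algebra_simps)
      then have "fps_X ^ (n - r) dvd h r"
        using 1 by (simp only:) (intro dvd_add dvd_mult2)
      moreover have "fps_X ^ r dvd L r"
        unfolding L_def using fps_X_power_dvd_power[OF Q le_choose2[of r]]
        by (intro dvd_mult dvd_mult2) (simp add: Q_def)
      ultimately have "fps_X ^ r * fps_X ^ (n - r) dvd L r * h r"
        by (intro mult_dvd_mono)
      then show ?thesis
        using that by (simp flip: power_add)
    qed
    then show ?thesis
      unfolding eq by (intro dvd_sum) simp
  qed
  ultimately have "(\<lambda>n. E6 * E6 * finv (xi_denom (Suc n))) \<longlonglongrightarrow> qpoch_inf (fps_X ^ 2) (fps_X ^ 2) * sect 3 1 xi_sum"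
    by (rule tendsto_fps_dvd[rotated])
  moreover have "(\<lambda>n. xi_denom (Suc n)) \<longlonglongrightarrow> qpoch_inf fps_X (fps_X ^ 6) * qpoch_inf (fps_X ^ 5) (fps_X ^ 6)"
    unfolding xi_denom_def by (rule LIMSEQ_Suc) (intro tendsto_fps_mult tendsto_qpoch; simp)
  \<comment> \<open>Multiplying back by the denominators makes the sequence constant, which
    determines the limit.\<close>
  ultimately have "(\<lambda>n. E6 * E6 * finv (xi_denom (Suc n)) * xi_denom (Suc n)) \<longlonglongrightarrow>
      qpoch_inf (fps_X ^ 2) (fps_X ^ 2) * sect 3 1 xi_sum * (qpoch_inf fps_X (fps_X ^ 6) * qpoch_inf (fps_X ^ 5) (fps_X ^ 6))"
    by (rule tendsto_fps_mult)
  moreover have "E6 * E6 * finv (xi_denom (Suc n)) * xi_denom (Suc n) = E6 * E6" for n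
    using xi_denom_inverse[of "Suc n"] by (simp add: mult_ac)
  ultimately show ?thesis
    by (simp add: LIMSEQ_const_iff)
qed

text \<open>Both sides are compared after multiplication by \<open>C\<close>, which can be cancelled
  because its constant term is 1. The products with signs in \<open>T\<close> combine with those in
  \<open>C\<close> to \<open>(q^2;q^12)_inf\<close> and \<open>(q^10;q^12)_inf\<close>; together
  with \<open>(q^6;q^12)_inf\<close> these make up \<open>(q^2;q^4)_inf\<close>.\<close>

lemma sect_xi_sum_theta: "sect 3 1 xi_sum * theta (-1) 2 0 = theta (-1) 6 0 * theta 1 3 2"
proof -
  let ?X = "fps_X :: int fps"
  let ?p = "\<lambda>a q. qpoch_inf (?X ^ a) (?X ^ q)"
  have split: "?p a q = ?p a (2 * q) * ?p (a + q) (2 * q)" if "a > 0" "q > 0" for a q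
    using qpoch_inf_split2[of "?X ^ a" "?X ^ q"] that
    by (simp add: fps_X_power_nth mult.commute flip: power_add power_mult)
  have split3: "?p 2 4 = ?p 2 12 * ?p 6 12 * ?p 10 12"
    using qpoch_inf_split3[of "?X ^ 2" "?X ^ 4"] by (simp flip: power_add power_mult)
  have sq: "qpoch_inf (?X ^ a) (?X ^ q) * qpoch_inf (- (?X ^ a)) (?X ^ q) = ?p (2 * a) (2 * q)" if "a > 0" "q > 0" for a q
    using qpoch_inf_square[of "?X ^ a" "?X ^ q"] that
    by (simp add: fps_X_power_nth mult.commute mult_2_right flip: power_add power_mult)
  have phi: "theta (-1) 2 0 = ?p 2 4 * ?p 2 4 * ?p 4 4" "theta (-1) 6 0 = ?p 6 12 * ?p 6 12 * ?p 12 12"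
    by (simp_all add: jacobi_triple_product flip: fps_const_neg)
  have T: "theta 1 3 2 = qpoch_inf (- (?X ^ 5)) (?X ^ 6) * qpoch_inf (- (?X ^ 1)) (?X ^ 6) * ?p 6 6"
    by (simp add: jacobi_triple_product)
  have E2: "?p 2 2 = ?p 2 4 * ?p 4 4" and E6: "?p 6 6 = ?p 6 12 * ?p 12 12"
    using split[of 2 2] split[of 6 6] by simp_all
  have s1: "?p 1 6 * qpoch_inf (- (?X ^ 1)) (?X ^ 6) = ?p 2 12"
    and s5: "?p 5 6 * qpoch_inf (- (?X ^ 5)) (?X ^ 6) = ?p 10 12"
    using sq[of 1 6] sq[of 5 6] by simp_all
  define F where "F = sect 3 1 xi_sum"
  define C where "C = ?p 2 2 * (?p 1 6 * ?p 5 6)"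
  have CF: "C * F = ?p 6 6 * ?p 6 6"
    using sect_xi_sum_product by (simp add: C_def F_def mult_ac)
  have "C * (F * theta (-1) 2 0) = ?p 6 6 * ?p 6 6 * (?p 2 4 * ?p 2 4 * ?p 4 4)"
    unfolding phi by (simp only: CF[symmetric] mult_ac)
  also have "\<dots> = ?p 6 6 * (?p 6 12 * ?p 12 12) * (?p 2 4 * (?p 2 12 * ?p 6 12 * ?p 10 12) * ?p 4 4)"
    by (simp only: E6[symmetric] split3[symmetric])
  also have "\<dots> = (?p 2 4 * ?p 4 4) * (?p 6 12 * ?p 6 12 * ?p 12 12) * (?p 2 12 * ?p 10 12 * ?p 6 6)"
    by (simp only: mult_ac)
  also have "\<dots> = C * (theta (-1) 6 0 * theta 1 3 2)"
    unfolding C_def phi T E2[symmetric] s1[symmetric] s5[symmetric] by (simp only: mult_ac)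
  finally have "C * (F * theta (-1) 2 0) = C * (theta (-1) 6 0 * theta 1 3 2)" .
  moreover have "fps_nth C 0 = 1"
    by (simp add: C_def qpoch_inf_nth_0)
  then have "C \<noteq> 0"
    by auto
  ultimately show ?thesis
    by (simp add: F_def)
qed

theorem theorem4p9:
  fixes n :: nat
  shows "[p_xi (12 * n + 4) = p_xi (3 * n + 1)] (mod 8)"
proof -
  define F where "F = sect 3 1 xi_sum"
  \<comment> \<open>This factor 2 lifts the congruence modulo 4 for \<open>F\<close> to one modulo
    8; the indices match because \<open>12 * n + 4 = 3 * (4 * n + 1) + 1\<close>.\<close>
  have p: "p_xi (3 * m + 1) = 2 * fps_nth F m" for m
    by (simp add: p_xi_def xi_def xi_sum_def[symmetric] F_def numeral_fps_const)
  have "4 dvd sect 4 1 F - F"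
    unfolding F_def by (rule sect_theta_quotient_cong[OF sect_xi_sum_theta])
  then obtain g where "sect 4 1 F - F = 4 * g" ..
  then have "fps_nth (sect 4 1 F) n - fps_nth F n = 4 * fps_nth g n"
    by (metis fps_sub_nth fps_mult_left_const_nth numeral_fps_const)
  then have "fps_nth F (4 * n + 1) - fps_nth F n = 4 * fps_nth g n"
    by simp
  then have "p_xi (12 * n + 4) - p_xi (3 * n + 1) = 8 * fps_nth g n"
    using p[of "4 * n + 1"] p[of n] by (simp add: add.commute)
  then show ?thesis
    by (simp add: cong_iff_dvd_diff)
qed

end
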